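(* Let $n\ge 3$. Then $$ |R(D_n,[D_n])| = \begin{cases} (\frac{n}{2}+2)\,|\Upsilon_n| & \text{if } 8\mid n,\\ (\frac{n}{2}+1)\,|\Upsilon_n| & \text{if } 4\mid n \text{ but } 8\nmid n,\\ (n+1)\,|\Upsilon_n| & \text{if } 2\mid n \text{ but } 4\nmid n,\\ |\Upsilon_n| & \text{if } n \text{ is odd.} \end{cases} $$
   Context: $D_n=\langle x,t\mid x^n=1,\ t^2=1,\ xt=tx^{-1}\rangle$ is the dihedral group of order $2n$. $B=\mathrm{Perm}(D_n)$ is the group of all permutations of the underlying set of $D_n$, and $\lambda:D_n\to B$, $\lambda(g)(h)=gh$, is the left regular representation. A subgroup $N\le B$ is regular if it acts transitively and fixed-point freely (i.e. simply transitively) on $D_n$. $R(D_n,[D_n])$ is the set of regular subgroups $N\le B$ such that $N\cong D_n$ and $\lambda(D_n)\le \mathrm{Norm}_B(N)$, where $\mathrm{Norm}_B(N)$ is the normalizer of $N$ in $B$. $U_n=(\mathbb{Z}/n\mathbb{Z})^*$ is the group of units mod $n$, and $\Upsilon_n=\{u\in U_n\mid u^2=1\}$. *)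

theory Defs
  imports "HOL-Algebra.Algebra" "HOL-Number_Theory.Residues"
begin

text \<open>
  The dihedral group of order \<open>2n\<close>: the pair \<open>(i, s)\<close> stands for \<open>x\<^sup>i t\<^sup>s\<close>, with \<open>i\<close> reduced
  modulo \<open>n\<close> and \<open>s\<close> telling whether the factor \<open>t\<close> is present; the product comes from
  \<open>t x\<^sup>j = x\<^sup>-\<^sup>j t\<close>. The lemmas below (\<open>order_dihedral_group\<close>, \<open>dihedral_relations\<close>,
  \<open>dihedral_generated\<close>, \<open>dihedral_universal\<close>) show that this is the group with presentation
  \<open>x\<^sup>n = 1\<close>, \<open>t\<^sup>2 = 1\<close>, \<open>x t = t x\<^sup>-\<^sup>1\<close>.
\<close>

definition dihedral_group :: "nat \<Rightarrow> (int \<times> bool) monoid" where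
  "dihedral_group n =
     \<lparr>carrier = {0..<int n} \<times> UNIV,
      monoid.mult = (\<lambda>(i, s) (j, t). ((if s then i - j else i + j) mod int n, s \<noteq> t)),
      monoid.one = (0, False)\<rparr>"

definition left_regular_rep :: "('a, 'm) monoid_scheme \<Rightarrow> 'a \<Rightarrow> ('a \<Rightarrow> 'a)" where
  "left_regular_rep G g = (\<lambda>h \<in> carrier G. g \<otimes>\<^bsub>G\<^esub> h)"

definition regular_subgroup :: "('a \<Rightarrow> 'a) set \<Rightarrow> 'a set \<Rightarrow> bool" where
  "regular_subgroup N S \<longleftrightarrow>
     subgroup N (BijGroup S) \<and>
     (\<forall>a\<in>S. \<forall>b\<in>S. \<exists>f\<in>N. f a = b) \<and>
     (\<forall>f\<in>N. \<forall>a\<in>S. f a = a \<longrightarrow> f = \<one>\<^bsub>BijGroup S\<^esub>)"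

text \<open>\<open>regular_set G M\<close> is \<open>R(G, [M])\<close>, where \<open>[M]\<close> is the isomorphism class of \<open>M\<close>.\<close>

definition regular_set :: "('a, 'm) monoid_scheme \<Rightarrow> ('b, 'k) monoid_scheme \<Rightarrow> ('a \<Rightarrow> 'a) set set" where
  "regular_set G M =
     {N. regular_subgroup N (carrier G) \<and>
         (BijGroup (carrier G))\<lparr>carrier := N\<rparr> \<cong> M \<and>
         left_regular_rep G ` carrier G \<subseteq> normalizer (BijGroup (carrier G)) N}"

definition Upsilon :: "nat \<Rightarrow> int set" where
  "Upsilon n = {u \<in> Units (residue_ring (int n)).
     u [^]\<^bsub>residue_ring (int n)\<^esub> (2::nat) = \<one>\<^bsub>residue_ring (int n)\<^esub>}"

lemma group_dihedral_group:
  assumes "n > 0"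
  shows "group (dihedral_group n)"
proof (rule groupI)
  fix x y z
  assume xyz: "x \<in> carrier (dihedral_group n)" "y \<in> carrier (dihedral_group n)"
    "z \<in> carrier (dihedral_group n)"
  show "x \<otimes>\<^bsub>dihedral_group n\<^esub> y \<otimes>\<^bsub>dihedral_group n\<^esub> z =
        x \<otimes>\<^bsub>dihedral_group n\<^esub> (y \<otimes>\<^bsub>dihedral_group n\<^esub> z)"
    by (cases x; cases y; cases z)
       (auto simp: dihedral_group_def mod_simps algebra_simps)
next
  fix x assume x: "x \<in> carrier (dihedral_group n)"
  obtain i s where x_eq: "x = (i, s)" by (cases x)
  show "\<exists>y\<in>carrier (dihedral_group n). y \<otimes>\<^bsub>dihedral_group n\<^esub> x = \<one>\<^bsub>dihedral_group n\<^esub>"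
    by (rule bexI[of _ "(if s then i else (- i) mod int n, s)"])
       (use x assms in \<open>auto simp: x_eq dihedral_group_def mod_simps\<close>)
qed (use assms in \<open>auto simp: dihedral_group_def\<close>)

lemma order_dihedral_group: "order (dihedral_group n) = 2 * n"
  by (simp add: order_def dihedral_group_def card_cartesian_product)

lemma dihedral_x_pow:
  "(1 mod int n, False) [^]\<^bsub>dihedral_group n\<^esub> (k::nat) = (int k mod int n, False)"
  by (induction k) (simp_all add: nat_pow_def dihedral_group_def mod_simps add.commute)

lemma dihedral_relations:
  fixes n :: nat
  assumes "n > 0"
  defines "D \<equiv> dihedral_group n" and "x \<equiv> (1 mod int n, False)" and "t \<equiv> (0 :: int, True)"
  shows "x \<in> carrier D" "t \<in> carrier D"
    "x [^]\<^bsub>D\<^esub> n = \<one>\<^bsub>D\<^esub>" "t [^]\<^bsub>D\<^esub> (2::nat) = \<one>\<^bsub>D\<^esub>" "x \<otimes>\<^bsub>D\<^esub> t = t \<otimes>\<^bsub>D\<^esub> inv\<^bsub>D\<^esub> x"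
proof -
  interpret group D unfolding D_def using assms(1) by (rule group_dihedral_group)
  show x: "x \<in> carrier D" and t: "t \<in> carrier D"
    using assms(1) by (auto simp: D_def x_def t_def dihedral_group_def)
  show "x [^]\<^bsub>D\<^esub> n = \<one>\<^bsub>D\<^esub>"
    unfolding D_def x_def dihedral_x_pow by (simp add: dihedral_group_def)
  show "t [^]\<^bsub>D\<^esub> (2::nat) = \<one>\<^bsub>D\<^esub>"
    by (simp add: numeral_2_eq_2 t_def D_def dihedral_group_def nat_pow_def)
  have "t = x \<otimes>\<^bsub>D\<^esub> t \<otimes>\<^bsub>D\<^esub> x"
    by (simp add: t_def x_def D_def dihedral_group_def mod_simps)
  then have "t \<otimes>\<^bsub>D\<^esub> inv\<^bsub>D\<^esub> x = x \<otimes>\<^bsub>D\<^esub> t \<otimes>\<^bsub>D\<^esub> x \<otimes>\<^bsub>D\<^esub> inv\<^bsub>D\<^esub> x" by simp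
  also have "\<dots> = x \<otimes>\<^bsub>D\<^esub> t"
    using x t by (simp add: m_assoc)
  finally show "x \<otimes>\<^bsub>D\<^esub> t = t \<otimes>\<^bsub>D\<^esub> inv\<^bsub>D\<^esub> x" by simp
qed

lemma dihedral_generated:
  fixes n :: nat
  assumes "n > 0"
  shows "generate (dihedral_group n) {(1 mod int n, False), (0, True)} = carrier (dihedral_group n)"
    (is "generate ?D {?x, ?t} = _")
proof -
  interpret group ?D using assms by (rule group_dihedral_group)
  note rel = dihedral_relations[OF assms]
  have pow: "?x [^]\<^bsub>?D\<^esub> k \<in> generate ?D {?x, ?t}" for k :: nat
  proof (induction k)
    case 0
    then show ?case by (simp add: generate.one)
  next
    case (Suc k)
    then show ?case by (auto intro: generate.eng generate.incl)
  qed
  have "p \<in> generate ?D {?x, ?t}" if "p \<in> carrier ?D" for p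
  proof -
    obtain i s where p: "p = (i, s)" by (cases p)
    with that have i: "0 \<le> i" "i < int n" by (auto simp: dihedral_group_def)
    have px: "?x [^]\<^bsub>?D\<^esub> nat i = (i, False)"
      using i by (simp add: dihedral_x_pow)
    show ?thesis
    proof (cases s)
      case True
      have "p = ?x [^]\<^bsub>?D\<^esub> nat i \<otimes>\<^bsub>?D\<^esub> ?t"
        unfolding px using True i by (simp add: p dihedral_group_def)
      then show ?thesis using pow[of "nat i"] by (auto intro: generate.eng generate.incl)
    next
      case False
      then show ?thesis using pow[of "nat i"] px p by simp
    qed
  qed
  moreover have "generate ?D {?x, ?t} \<subseteq> carrier ?D"
    using rel(1,2) by (intro generate_incl) auto
  ultimately show ?thesis by blast
qed

lemma dihedral_universal:
  fixes H (structure) and n :: nat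
  assumes "n > 0" "group H" and ab: "a \<in> carrier H" "b \<in> carrier H"
    and rel: "a [^] n = \<one>" "b [^] (2::nat) = \<one>" "a \<otimes> b = b \<otimes> inv a"
  shows "\<exists>f\<in>hom (dihedral_group n) H. f (1 mod int n, False) = a \<and> f (0, True) = b"
proof -
  interpret group H by fact
  have per: "a [^] (k mod int n) = a [^] k" for k :: int
  proof -
    have "a [^] int n = \<one>" using rel(1) by (simp add: int_pow_int)
    then have "a [^] (int n * (k div int n)) = \<one>"
      using ab by (simp add: int_pow_pow[symmetric])
    then have "a [^] (int n * (k div int n) + k mod int n) = a [^] (k mod int n)"
      using ab by (subst int_pow_mult) auto
    then show ?thesis by simp
  qed
  have bb: "b \<otimes> b = \<one>" using rel(2) ab by (simp add: numeral_2_eq_2)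
  then have binv: "inv b = b" using ab by (metis inv_equality)
  have conj_hom: "(\<lambda>y. b \<otimes> y \<otimes> b) \<in> hom H H"
  proof (rule homI)
    fix y z assume yz: "y \<in> carrier H" "z \<in> carrier H"
    have "b \<otimes> y \<otimes> b \<otimes> (b \<otimes> z \<otimes> b) = b \<otimes> y \<otimes> (b \<otimes> b) \<otimes> z \<otimes> b"
      using ab yz by (simp add: m_assoc)
    then show "b \<otimes> (y \<otimes> z) \<otimes> b = b \<otimes> y \<otimes> b \<otimes> (b \<otimes> z \<otimes> b)"
      using ab yz bb by (simp add: m_assoc)
  qed (use ab in auto)
  have ba: "b \<otimes> a \<otimes> b = inv a"
    using rel(3) ab bb by (metis inv_closed m_assoc l_one)
  interpret cj: group_hom H H "\<lambda>y. b \<otimes> y \<otimes> b"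
    using conj_hom by unfold_locales
  have flip: "b \<otimes> a [^] j = a [^] (- j) \<otimes> b" for j :: int
  proof -
    have "b \<otimes> a [^] j \<otimes> b = inv a [^] j"
      using cj.hom_int_pow[of a j] ab ba by simp
    also have "\<dots> = a [^] (- j)"
      using ab by (simp add: int_pow_inv int_pow_neg)
    finally have "b \<otimes> a [^] j \<otimes> b \<otimes> b = a [^] (- j) \<otimes> b" by simp
    then show ?thesis using ab bb by (simp add: m_assoc)
  qed
  define f where "f = (\<lambda>(i :: int, s). a [^] i \<otimes> (if s then b else \<one>))"
  have "f \<in> hom (dihedral_group n) H"
  proof (rule homI)
    fix p q assume "p \<in> carrier (dihedral_group n)" "q \<in> carrier (dihedral_group n)"
    obtain i s j t where pq: "p = (i, s)" "q = (j, t)" by (cases p; cases q)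
    have flip': "b \<otimes> (a [^] j \<otimes> z) = a [^] (- j) \<otimes> (b \<otimes> z)" if "z \<in> carrier H" for z
      using flip[of j] ab that by (metis int_pow_closed m_assoc)
    show "f (p \<otimes>\<^bsub>dihedral_group n\<^esub> q) = f p \<otimes> f q"
      using ab bb flip' flip[of j] int_pow_mult[of a i "-j"] int_pow_mult[of a i j]
      by (cases s; cases t) (simp_all add: f_def pq dihedral_group_def per m_assoc)
  qed (use ab in \<open>auto simp: f_def\<close>)
  moreover have "f (1 mod int n, False) = a" "f (0, True) = b"
    using ab by (simp_all add: f_def per int_pow_1)
  ultimately show ?thesis by blast
qed

end

theory Submission
  imports Defs
begin

text \<open>
  Why the count comes out. Let \<open>G = D\<^sub>n\<close> and let \<open>N\<close> be a regular subgroup of \<open>Perm(G)\<close> with an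
  isomorphism \<open>\<psi> : D\<^sub>n \<rightarrow> N\<close>. Evaluation at the identity, \<open>\<phi>(d) = \<psi>(d)(1)\<close>, is a bijection
  \<open>D\<^sub>n \<rightarrow> G\<close> that turns \<open>N\<close> into left multiplication on \<open>D\<^sub>n\<close>, and \<open>\<lambda>(G)\<close> normalises \<open>N\<close>
  exactly when every \<open>\<phi>\<^sup>-\<^sup>1 \<lambda>(g) \<phi>\<close> lies in the holomorph of \<open>D\<^sub>n\<close>. Two such charts give the same
  \<open>N\<close> exactly when they differ by an automorphism of \<open>D\<^sub>n\<close>. So the number sought is the number of
  holomorph charts modulo \<open>Aut(D\<^sub>n)\<close>, and it is the size of any transversal
  (\<open>card_regular_set_transversal\<close>).

  For \<open>n \<ge> 3\<close> the automorphisms are \<open>x\<^sup>j t\<^sup>s \<mapsto> x\<^sup>u\<^sup>j\<^sup>+\<^sup>s\<^sup>b t\<^sup>s\<close> with \<open>u\<close> a unit (\<open>iso_aut\<close>), so a holomorph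
  chart intertwines left translation by \<open>g\<close> with an affine map of linear part \<open>u(g)\<close>
  (\<open>holomorph_chart_iff\<close>). Since \<open>u\<close> takes values in an abelian group in which the images of
  reflections are involutions, \<open>u(x)\<^sup>2 = 1\<close>; hence translation by \<open>x\<^sup>2\<close> is a mere shift of the curve
  \<open>j \<mapsto> \<phi>(x\<^sup>j)\<close>. Comparing orders, and after reparametrising by a unit, that shift is \<open>j \<mapsto> j + 2\<close>, so the
  curve is \<open>x\<^sup>2\<^sup>l \<mapsto> x\<^sup>2\<^sup>l\<close>, \<open>x\<^sup>2\<^sup>l\<^sup>+\<^sup>1 \<mapsto> x\<^sup>2\<^sup>l y\<close> for a single element \<open>y\<close> of \<open>G\<close> (\<open>obtain_curve\<close>).
  The other half of the chart is the translate of this curve by an element outside it,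
  run through at a speed \<open>q\<close> with \<open>q\<^sup>2 = 1\<close>. This accounts for the factor \<open>|\<Upsilon>\<^sub>n|\<close>.

  It remains to count the \<open>y\<close>. For odd \<open>n\<close> the curve closes up only for \<open>y = x\<close>. For even \<open>n\<close> every
  reflection is possible (\<open>n\<close> of them), and a rotation \<open>y = x\<^sup>1\<^sup>+\<^sup>d\<close> is possible exactly when \<open>d\<close> is
  even and \<open>4d = 0\<close> modulo \<open>n\<close> (\<open>curve_extendable\<close>, \<open>chart_is_holomorph_chart\<close>): there are \<open>1\<close>, \<open>2\<close> or \<open>4\<close> such rotations
  according to the power of \<open>2\<close> in \<open>n\<close>. The only remaining freedom is reparametrisation by a unit \<open>w\<close> with \<open>2w = 2\<close>,
  that is \<open>w = 1\<close> or \<open>w = 1 + n/2\<close>; the second is a unit exactly when \<open>4\<close> divides \<open>n\<close>, and then it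
  identifies \<open>y\<close> with \<open>x\<^sup>n\<^sup>/\<^sup>2 y\<close>, halving the count. This yields \<open>1\<close>, \<open>n + 1\<close>, \<open>n/2 + 1\<close> and
  \<open>n/2 + 2\<close> choices of \<open>y\<close> (\<open>card_reps\<close>).
\<close>

section \<open>Normalised regular subgroups and charts\<close>

lemma (in group) mem_normalizer_iff:
  assumes "N \<subseteq> carrier G" "g \<in> carrier G"
  shows "g \<in> normalizer G N \<longleftrightarrow> (\<lambda>m. g \<otimes> m \<otimes> inv g) ` N = N"
proof -
  have "g <# N #> inv g = (\<lambda>m. g \<otimes> m \<otimes> inv g) ` N"
    by (auto simp: l_coset_def r_coset_def)
  then show ?thesis
    using assms by (simp add: normalizer_def stabilizer_def)
qed

text \<open>
  Left multiplication by \<open>d\<close>, carried over to the carrier of \<open>G\<close> along a bijection \<open>\<phi>\<close>; it is restricted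
  to the carrier because elements of \<open>BijGroup\<close> are extensional functions.
\<close>

definition transport ::
  "('a, 'm) monoid_scheme \<Rightarrow> ('b, 'k) monoid_scheme \<Rightarrow> ('b \<Rightarrow> 'a) \<Rightarrow> 'b \<Rightarrow> 'a \<Rightarrow> 'a"
  where "transport G M \<phi> d =
    (\<lambda>a\<in>carrier G. \<phi> (d \<otimes>\<^bsub>M\<^esub> inv_into (carrier M) \<phi> a))"

text \<open>
  The last clause says that \<open>\<phi>\<close> conjugates the left translations of \<open>G\<close> into the holomorph of \<open>M\<close>, whose
  elements are the maps \<open>d \<mapsto> \<alpha>(d) h\<close>. Fixing the identity as base point leaves only automorphisms
  of \<open>M\<close> as ambiguity.
\<close>

definition holomorph_chart ::
  "('a, 'm) monoid_scheme \<Rightarrow> ('b, 'k) monoid_scheme \<Rightarrow> ('b \<Rightarrow> 'a) \<Rightarrow> bool"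
  where "holomorph_chart G M \<phi> \<longleftrightarrow>
    bij_betw \<phi> (carrier M) (carrier G) \<and> \<phi> \<one>\<^bsub>M\<^esub> = \<one>\<^bsub>G\<^esub> \<and>
    (\<forall>g\<in>carrier G. \<exists>\<alpha>\<in>iso M M. \<exists>h\<in>carrier M. \<forall>d\<in>carrier M.
       g \<otimes>\<^bsub>G\<^esub> \<phi> d = \<phi> (\<alpha> d \<otimes>\<^bsub>M\<^esub> h))"

locale group_pair = G: group G + M: group M for G (structure) and M (structure)
begin

abbreviation B where "B \<equiv> BijGroup (carrier G)"
abbreviation T where "T \<equiv> transport G M"
abbreviation L where "L \<equiv> left_regular_rep G"

sublocale B: group B by (rule group_BijGroup)

lemma mult_B: "f \<in> carrier B \<Longrightarrow> f' \<in> carrier B \<Longrightarrow> a \<in> carrier G \<Longrightarrow> (f \<otimes>\<^bsub>B\<^esub> f') a = f (f' a)"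
  by (simp add: BijGroup_def compose_def)

lemma one_B: "a \<in> carrier G \<Longrightarrow> \<one>\<^bsub>B\<^esub> a = a"
  by (simp add: BijGroup_def)

lemma B_closed: "f \<in> carrier B \<Longrightarrow> a \<in> carrier G \<Longrightarrow> f a \<in> carrier G"
  by (auto simp: BijGroup_def Bij_def bij_betw_def)

lemma B_eqI:
  assumes "f \<in> carrier B" "f' \<in> carrier B" "\<And>a. a \<in> carrier G \<Longrightarrow> f a = f' a"
  shows "f = f'"
  using assms by (intro extensionalityI[of _ "carrier G"]) (auto simp: BijGroup_def Bij_def)

lemma L_closed:
  assumes "g \<in> carrier G"
  shows "L g \<in> carrier B"
proof -
  have "bij_betw (L g) (carrier G) (carrier G)"
    using assms
    by (intro bij_betw_byWitness[where f' = "\<lambda>a. inv g \<otimes> a"])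
       (auto simp: left_regular_rep_def G.m_assoc[symmetric])
  then show ?thesis by (simp add: BijGroup_def Bij_def left_regular_rep_def)
qed

lemma L_apply: "a \<in> carrier G \<Longrightarrow> L g a = g \<otimes> a"
  by (simp add: left_regular_rep_def)

lemma transport_apply:
  assumes "bij_betw \<phi> (carrier M) (carrier G)" "a \<in> carrier M"
  shows "T \<phi> d (\<phi> a) = \<phi> (d \<otimes>\<^bsub>M\<^esub> a)"
  using assms by (auto simp: transport_def bij_betw_def)

lemma transport_closed:
  assumes "bij_betw \<phi> (carrier M) (carrier G)" "d \<in> carrier M"
  shows "T \<phi> d \<in> carrier B"
proof -
  have "bij_betw (\<lambda>a. d \<otimes>\<^bsub>M\<^esub> a) (carrier M) (carrier M)"
    using assms(2)
    by (intro bij_betw_byWitness[where f' = "\<lambda>a. inv\<^bsub>M\<^esub> d \<otimes>\<^bsub>M\<^esub> a"]) (auto simp: M.m_assoc[symmetric])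
  then have "bij_betw (\<phi> \<circ> ((\<lambda>a. d \<otimes>\<^bsub>M\<^esub> a) \<circ> inv_into (carrier M) \<phi>)) (carrier G) (carrier G)"
    using assms(1) by (blast intro: bij_betw_trans bij_betw_inv_into)
  then have "bij_betw (T \<phi> d) (carrier G) (carrier G)"
    by (rule bij_betw_cong[THEN iffD1, rotated]) (simp add: transport_def)
  then show ?thesis
    by (simp add: BijGroup_def Bij_def transport_def)
qed

lemma chart_eqI:
  assumes "bij_betw \<phi> (carrier M) (carrier G)" "f \<in> carrier B" "f' \<in> carrier B"
    "\<And>a. a \<in> carrier M \<Longrightarrow> f (\<phi> a) = f' (\<phi> a)"
  shows "f = f'"
proof (rule B_eqI)
  fix a assume "a \<in> carrier G"
  then obtain a' where "a' \<in> carrier M" "a = \<phi> a'" using assms(1) by (auto simp: bij_betw_def)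
  then show "f a = f' a" using assms(4) by simp
qed (use assms in auto)

lemma transport_mult:
  assumes "bij_betw \<phi> (carrier M) (carrier G)" "d \<in> carrier M" "e \<in> carrier M"
  shows "T \<phi> (d \<otimes>\<^bsub>M\<^esub> e) = T \<phi> d \<otimes>\<^bsub>B\<^esub> T \<phi> e"
  using assms
  by (intro chart_eqI[OF assms(1)])
     (auto simp: transport_closed mult_B transport_apply M.m_assoc bij_betwE[OF assms(1)])

lemma transport_hom:
  assumes "bij_betw \<phi> (carrier M) (carrier G)"
  shows "group_hom M B (T \<phi>)"
  by unfold_locales (auto simp: hom_def transport_closed transport_mult assms)

lemma inj_transport:
  assumes "bij_betw \<phi> (carrier M) (carrier G)"
  shows "inj_on (T \<phi>) (carrier M)"
proof (rule inj_onI)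
  fix d e assume de: "d \<in> carrier M" "e \<in> carrier M" "T \<phi> d = T \<phi> e"
  have "\<phi> d = \<phi> e"
    using transport_apply[OF assms M.one_closed, of d] transport_apply[OF assms M.one_closed, of e] de
    by simp
  then show "d = e" using de bij_betw_imp_inj_on[OF assms] by (simp only: inj_on_eq_iff)
qed

lemma iso_transport:
  assumes "bij_betw \<phi> (carrier M) (carrier G)"
  shows "T \<phi> \<in> iso M (B\<lparr>carrier := T \<phi> ` carrier M\<rparr>)"
  using inj_transport[OF assms] transport_mult[OF assms]
  by (auto simp: iso_def hom_def bij_betw_def)

lemma transport_regular:
  assumes "bij_betw \<phi> (carrier M) (carrier G)"
  shows "regular_subgroup (T \<phi> ` carrier M) (carrier G)"
proof -
  interpret h: group_hom M B "T \<phi>" by (rule transport_hom[OF assms])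
  have "\<exists>f\<in>T \<phi> ` carrier M. f a = b" if ab: "a \<in> carrier G" "b \<in> carrier G" for a b
  proof -
    obtain a' b' where "a = \<phi> a'" "b = \<phi> b'" and ab': "a' \<in> carrier M" "b' \<in> carrier M"
      using ab bij_betw_imp_surj_on[OF assms] by blast
    then have "T \<phi> (b' \<otimes>\<^bsub>M\<^esub> inv\<^bsub>M\<^esub> a') a = b"
      using transport_apply[OF assms, of a' "b' \<otimes>\<^bsub>M\<^esub> inv\<^bsub>M\<^esub> a'"] by (simp add: M.m_assoc)
    then show ?thesis using ab' by blast
  qed
  moreover have "T \<phi> d = \<one>\<^bsub>B\<^esub>" if d: "d \<in> carrier M" "a \<in> carrier G" "T \<phi> d a = a" for d a
  proof -
    obtain a' where a': "a = \<phi> a'" "a' \<in> carrier M"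
      using d(2) unfolding bij_betw_imp_surj_on[OF assms, symmetric] by (rule imageE)
    then have "d \<otimes>\<^bsub>M\<^esub> a' = a'"
      using d transport_apply[OF assms a'(2), of d] bij_betw_imp_inj_on[OF assms]
      by (metis M.m_closed inj_on_eq_iff)
    then have "d = \<one>\<^bsub>M\<^esub>" using d a' by simp
    then show ?thesis by simp
  qed
  ultimately show ?thesis
    by (auto simp: regular_subgroup_def h.img_is_subgroup)
qed

text \<open>
  If \<open>\<phi>\<close> turns translation by \<open>g\<close> into \<open>d \<mapsto> \<alpha>(d) h\<close>, then conjugation by \<open>\<lambda>(g)\<close> sends
  the permutation belonging to \<open>d\<close> to the one belonging to \<open>\<alpha>(d)\<close>; as \<open>\<alpha>\<close> is onto, the whole group is preserved.
\<close>

lemma chart_imp_regular_set: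
  assumes "holomorph_chart G M \<phi>"
  shows "T \<phi> ` carrier M \<in> regular_set G M"
proof -
  have bij: "bij_betw \<phi> (carrier M) (carrier G)"
    using assms by (simp add: holomorph_chart_def)
  have closed: "T \<phi> ` carrier M \<subseteq> carrier B"
    using transport_closed[OF bij] by auto
  have "L g \<in> normalizer B (T \<phi> ` carrier M)" if g: "g \<in> carrier G" for g
  proof -
    obtain \<alpha> h where \<alpha>: "\<alpha> \<in> iso M M" and h: "h \<in> carrier M"
      and eq: "\<And>d. d \<in> carrier M \<Longrightarrow> g \<otimes> \<phi> d = \<phi> (\<alpha> d \<otimes>\<^bsub>M\<^esub> h)"
      using assms g unfolding holomorph_chart_def by blast
    have \<alpha>M: "\<alpha> ` carrier M = carrier M" "\<And>d. d \<in> carrier M \<Longrightarrow> \<alpha> d \<in> carrier M"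
      using \<alpha> by (auto simp: iso_def bij_betw_def)
    have "L g \<otimes>\<^bsub>B\<^esub> T \<phi> d \<otimes>\<^bsub>B\<^esub> inv\<^bsub>B\<^esub> L g = T \<phi> (\<alpha> d)" if d: "d \<in> carrier M" for d
    proof -
      have "L g \<otimes>\<^bsub>B\<^esub> T \<phi> d = T \<phi> (\<alpha> d) \<otimes>\<^bsub>B\<^esub> L g"
      proof (rule chart_eqI[OF bij])
        fix a assume a: "a \<in> carrier M"
        have "\<alpha> (d \<otimes>\<^bsub>M\<^esub> a) \<otimes>\<^bsub>M\<^esub> h = \<alpha> d \<otimes>\<^bsub>M\<^esub> (\<alpha> a \<otimes>\<^bsub>M\<^esub> h)"
          using a d h \<alpha> \<alpha>M by (simp add: iso_def hom_def M.m_assoc)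
        then show "(L g \<otimes>\<^bsub>B\<^esub> T \<phi> d) (\<phi> a) = (T \<phi> (\<alpha> d) \<otimes>\<^bsub>B\<^esub> L g) (\<phi> a)"
          using a d g h \<alpha>M bij_betwE[OF bij]
          by (simp add: mult_B L_closed L_apply transport_closed[OF bij] transport_apply[OF bij] eq)
      qed (use d g \<alpha>M in \<open>auto simp: L_closed transport_closed[OF bij]\<close>)
      then show ?thesis
        using d g \<alpha>M
        by (simp add: B.m_assoc L_closed transport_closed[OF bij])
    qed
    then have "(\<lambda>m. L g \<otimes>\<^bsub>B\<^esub> m \<otimes>\<^bsub>B\<^esub> inv\<^bsub>B\<^esub> L g) ` T \<phi> ` carrier M = T \<phi> ` \<alpha> ` carrier M"
      unfolding image_image by (rule image_cong[OF refl])
    then show ?thesis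
      using \<alpha>M(1) by (simp add: B.mem_normalizer_iff[OF closed] L_closed g)
  qed
  moreover have "B\<lparr>carrier := T \<phi> ` carrier M\<rparr> \<cong> M"
    using M.iso_set_sym[OF iso_transport[OF bij]] by (auto simp: is_iso_def)
  ultimately show ?thesis
    using transport_regular[OF bij] by (auto simp: regular_set_def)
qed

text \<open>
  The chart is evaluation of an isomorphism \<open>M \<cong> N\<close> at the identity. Conjugation by \<open>\<lambda>(g)\<close>
  is an automorphism of \<open>N\<close>, and evaluating it at the identity gives the holomorph condition.
\<close>

lemma regular_set_imp_chart:
  assumes "N \<in> regular_set G M"
  obtains \<phi> where "holomorph_chart G M \<phi>" "N = T \<phi> ` carrier M"
proof -
  have sub: "subgroup N B"
    and trans: "\<And>a b. a \<in> carrier G \<Longrightarrow> b \<in> carrier G \<Longrightarrow> \<exists>f\<in>N. f a = b"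
    and free: "\<And>f a. f \<in> N \<Longrightarrow> a \<in> carrier G \<Longrightarrow> f a = a \<Longrightarrow> f = \<one>\<^bsub>B\<^esub>"
    and norm: "\<And>g. g \<in> carrier G \<Longrightarrow> L g \<in> normalizer B N"
    and "B\<lparr>carrier := N\<rparr> \<cong> M"
    using assms by (auto simp: regular_set_def regular_subgroup_def)
  have NB: "N \<subseteq> carrier B" using sub by (rule subgroup.subset)
  interpret N: group "B\<lparr>carrier := N\<rparr>"
    by (rule subgroup.subgroup_is_group[OF sub B.is_group])
  obtain \<psi> where \<psi>: "\<psi> \<in> iso M (B\<lparr>carrier := N\<rparr>)"
    using N.iso_sym[OF \<open>B\<lparr>carrier := N\<rparr> \<cong> M\<close>] by (auto simp: is_iso_def)
  have \<psi>_bij: "bij_betw \<psi> (carrier M) N" using \<psi> by (simp add: iso_def)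
  have \<psi>N: "\<psi> d \<in> N" if "d \<in> carrier M" for d using \<psi>_bij that by (auto simp: bij_betw_def)
  have \<psi>B: "\<psi> d \<in> carrier B" if "d \<in> carrier M" for d using \<psi>N NB that by blast
  have \<psi>_mult: "\<psi> (d \<otimes>\<^bsub>M\<^esub> e) = \<psi> d \<otimes>\<^bsub>B\<^esub> \<psi> e" if "d \<in> carrier M" "e \<in> carrier M" for d e
    using \<psi> that by (auto simp: iso_def hom_def)
  have cancel: "f = f'" if "f \<in> N" "f' \<in> N" "a \<in> carrier G" "f a = f' a" for f f' a
  proof -
    have B: "f \<in> carrier B" "f' \<in> carrier B" using that NB by auto
    have "(inv\<^bsub>B\<^esub> f' \<otimes>\<^bsub>B\<^esub> f) a = (inv\<^bsub>B\<^esub> f' \<otimes>\<^bsub>B\<^esub> f') a"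
      using B that by (simp only: mult_B B.inv_closed)
    then have "(inv\<^bsub>B\<^esub> f' \<otimes>\<^bsub>B\<^esub> f) a = a" using B that by (simp add: one_B)
    then have "inv\<^bsub>B\<^esub> f' \<otimes>\<^bsub>B\<^esub> f = \<one>\<^bsub>B\<^esub>"
      using that sub by (intro free) (auto simp: subgroup.m_closed subgroup.m_inv_closed)
    then show "f = f'" using B by (metis B.inv_closed B.inv_equality B.inv_inv)
  qed
  define \<phi> where "\<phi> d = \<psi> d \<one>" for d
  have \<phi>_mult: "\<phi> (d \<otimes>\<^bsub>M\<^esub> e) = \<psi> d (\<phi> e)" if "d \<in> carrier M" "e \<in> carrier M" for d e
    using that by (simp add: \<phi>_def \<psi>_mult mult_B \<psi>B)
  have bij: "bij_betw \<phi> (carrier M) (carrier G)"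
  proof (rule bij_betw_imageI)
    show "inj_on \<phi> (carrier M)"
      using \<psi>_bij cancel[OF \<psi>N \<psi>N G.one_closed] by (auto simp: \<phi>_def inj_on_def bij_betw_def)
    show "\<phi> ` carrier M = carrier G"
    proof
      show "\<phi> ` carrier M \<subseteq> carrier G" by (auto simp: \<phi>_def B_closed \<psi>B)
      show "carrier G \<subseteq> \<phi> ` carrier M"
        using trans[OF G.one_closed] \<psi>_bij by (fastforce simp: \<phi>_def bij_betw_def)
    qed
  qed
  have T\<psi>: "T \<phi> d = \<psi> d" if "d \<in> carrier M" for d
    using that by (intro chart_eqI[OF bij]) (auto simp: transport_closed bij \<psi>B transport_apply \<phi>_mult)
  have NT: "N = T \<phi> ` carrier M"
    using \<psi>_bij T\<psi> by (auto simp: bij_betw_def image_iff)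
  have "\<psi> \<one>\<^bsub>M\<^esub> = \<one>\<^bsub>B\<^esub>"
    using hom_one[OF _ M.is_group N.is_group, of \<psi>] \<psi> by (simp add: iso_def)
  then have one: "\<phi> \<one>\<^bsub>M\<^esub> = \<one>" by (simp add: \<phi>_def one_B)
  have "\<exists>\<alpha>\<in>iso M M. \<exists>h\<in>carrier M. \<forall>d\<in>carrier M. g \<otimes> \<phi> d = \<phi> (\<alpha> d \<otimes>\<^bsub>M\<^esub> h)"
    if g: "g \<in> carrier G" for g
  proof -
    define c where "c m = L g \<otimes>\<^bsub>B\<^esub> m \<otimes>\<^bsub>B\<^esub> inv\<^bsub>B\<^esub> L g" for m
    have cN: "c ` N = N"
      using norm[OF g] by (simp add: B.mem_normalizer_iff[OF NB] L_closed g c_def[abs_def])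
    have c_mult: "c (m \<otimes>\<^bsub>B\<^esub> m') = c m \<otimes>\<^bsub>B\<^esub> c m'" if "m \<in> carrier B" "m' \<in> carrier B" for m m'
    proof -
      have "inv\<^bsub>B\<^esub> L g \<otimes>\<^bsub>B\<^esub> (L g \<otimes>\<^bsub>B\<^esub> z) = z" if "z \<in> carrier B" for z
        using that L_closed[OF g] by (simp add: B.m_assoc[symmetric])
      then show ?thesis using that L_closed[OF g] by (simp add: c_def B.m_assoc)
    qed
    have "c \<in> iso (B\<lparr>carrier := N\<rparr>) (B\<lparr>carrier := N\<rparr>)"
    proof (rule isoI)
      show "c \<in> hom (B\<lparr>carrier := N\<rparr>) (B\<lparr>carrier := N\<rparr>)"
      proof (rule homI)
        fix m m' assume "m \<in> carrier (B\<lparr>carrier := N\<rparr>)" "m' \<in> carrier (B\<lparr>carrier := N\<rparr>)"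
        then have "m \<in> carrier B" "m' \<in> carrier B" using NB by auto
        then show "c (m \<otimes>\<^bsub>B\<lparr>carrier := N\<rparr>\<^esub> m') = c m \<otimes>\<^bsub>B\<lparr>carrier := N\<rparr>\<^esub> c m'"
          using c_mult[of m m'] by simp
      qed (use cN in auto)
      have "inj_on c N"
        using NB L_closed[OF g] by (auto simp: inj_on_def c_def subset_iff)
      then show "bij_betw c (carrier (B\<lparr>carrier := N\<rparr>)) (carrier (B\<lparr>carrier := N\<rparr>))"
        using cN by (simp add: bij_betw_def)
    qed
    then have \<alpha>: "inv_into (carrier M) \<psi> \<circ> (c \<circ> \<psi>) \<in> iso M M" (is "?\<alpha> \<in> _")
      by (intro iso_set_trans[OF iso_set_trans[OF \<psi>] M.iso_set_sym[OF \<psi>]])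
    obtain h where h: "h \<in> carrier M" "\<phi> h = g"
      using g unfolding bij_betw_imp_surj_on[OF bij, symmetric] by (elim imageE) simp
    have "g \<otimes> \<phi> d = \<phi> (?\<alpha> d \<otimes>\<^bsub>M\<^esub> h)" if d: "d \<in> carrier M" for d
    proof -
      have \<alpha>d: "?\<alpha> d \<in> carrier M" using \<alpha> d by (auto simp: iso_def hom_def)
      have "\<psi> (?\<alpha> d) = c (\<psi> d)"
        using bij_betw_inv_into_right[OF \<psi>_bij, of "c (\<psi> d)"] cN \<psi>N[OF d] by auto
      then have "\<phi> (?\<alpha> d \<otimes>\<^bsub>M\<^esub> h) = c (\<psi> d) (L g \<one>)"
        using \<alpha>d h g by (simp add: \<phi>_mult L_apply)
      also have "\<dots> = (c (\<psi> d) \<otimes>\<^bsub>B\<^esub> L g) \<one>"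
        using cN \<psi>N[OF d] NB g by (subst mult_B) (auto simp: L_closed)
      also have "c (\<psi> d) \<otimes>\<^bsub>B\<^esub> L g = L g \<otimes>\<^bsub>B\<^esub> \<psi> d"
        using L_closed[OF g] \<psi>B[OF d] by (simp add: c_def B.m_assoc)
      also have "(L g \<otimes>\<^bsub>B\<^esub> \<psi> d) \<one> = g \<otimes> \<phi> d"
        using L_closed[OF g] \<psi>B[OF d] by (simp add: mult_B L_apply B_closed \<phi>_def)
      finally show ?thesis ..
    qed
    then show ?thesis using \<alpha> h by blast
  qed
  then have "holomorph_chart G M \<phi>"
    using bij one by (simp add: holomorph_chart_def)
  then show ?thesis using NT that by blast
qed

lemma transport_comp_iso:
  assumes "bij_betw \<phi> (carrier M) (carrier G)" "\<alpha> \<in> iso M M"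
    and eq: "\<And>d. d \<in> carrier M \<Longrightarrow> \<phi>' d = \<phi> (\<alpha> d)"
  shows "T \<phi>' ` carrier M = T \<phi> ` carrier M"
proof -
  have \<alpha>: "bij_betw \<alpha> (carrier M) (carrier M)" "\<And>d e. d \<in> carrier M \<Longrightarrow> e \<in> carrier M \<Longrightarrow>
      \<alpha> (d \<otimes>\<^bsub>M\<^esub> e) = \<alpha> d \<otimes>\<^bsub>M\<^esub> \<alpha> e"
    using assms(2) by (auto simp: iso_def hom_def)
  have "bij_betw (\<phi> \<circ> \<alpha>) (carrier M) (carrier G)"
    using \<alpha>(1) assms(1) by (rule bij_betw_trans)
  then have bij': "bij_betw \<phi>' (carrier M) (carrier G)"
    by (rule bij_betw_cong[THEN iffD1, rotated]) (simp add: eq)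
  have "T \<phi>' d = T \<phi> (\<alpha> d)" if d: "d \<in> carrier M" for d
  proof (rule chart_eqI[OF bij'])
    fix a assume a: "a \<in> carrier M"
    have "T \<phi> (\<alpha> d) (\<phi>' a) = \<phi> (\<alpha> (d \<otimes>\<^bsub>M\<^esub> a))"
      using a d \<alpha> bij_betwE[OF \<alpha>(1)] by (simp add: eq transport_apply[OF assms(1)])
    then show "T \<phi>' d (\<phi>' a) = T \<phi> (\<alpha> d) (\<phi>' a)"
      using a d transport_apply[OF bij' a, of d] by (simp add: eq)
  qed (use d bij_betwE[OF \<alpha>(1)] in \<open>auto simp: transport_closed assms(1) bij'\<close>)
  then have "T \<phi>' ` carrier M = T \<phi> ` \<alpha> ` carrier M"
    unfolding image_image by (rule image_cong[OF refl])
  then show ?thesis using \<alpha>(1) by (simp add: bij_betw_def)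
qed

text \<open>
  Both charts identify \<open>M\<close> with the same group of permutations, so the two identifications differ by
  an automorphism; the base points make this an equation between the charts themselves.
\<close>

lemma transport_eq_imp_iso:
  assumes "bij_betw \<phi> (carrier M) (carrier G)" "bij_betw \<phi>' (carrier M) (carrier G)"
    and "\<phi> \<one>\<^bsub>M\<^esub> = \<one>" "\<phi>' \<one>\<^bsub>M\<^esub> = \<one>"
    and "T \<phi>' ` carrier M = T \<phi> ` carrier M"
  obtains \<alpha> where "\<alpha> \<in> iso M M" "\<And>d. d \<in> carrier M \<Longrightarrow> \<phi>' d = \<phi> (\<alpha> d)"
proof
  let ?\<alpha> = "inv_into (carrier M) (T \<phi>) \<circ> T \<phi>'"
  show \<alpha>: "?\<alpha> \<in> iso M M"
    using iso_transport[OF assms(2)] M.iso_set_sym[OF iso_transport[OF assms(1)]]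
    unfolding assms(5) by (rule iso_set_trans)
  fix d assume d: "d \<in> carrier M"
  have "T \<phi>' d \<in> T \<phi> ` carrier M" using assms(5) d by blast
  then have "T \<phi> (?\<alpha> d) = T \<phi>' d" by (simp add: f_inv_into_f)
  then have "T \<phi> (?\<alpha> d) (\<phi> \<one>\<^bsub>M\<^esub>) = T \<phi>' d (\<phi>' \<one>\<^bsub>M\<^esub>)" by (simp add: assms)
  moreover have "?\<alpha> d \<in> carrier M" using \<alpha> d by (auto simp: iso_def hom_def)
  ultimately show "\<phi>' d = \<phi> (?\<alpha> d)"
    using d by (simp only: transport_apply[OF assms(1)] transport_apply[OF assms(2)] M.one_closed M.r_one)
qed

lemma card_regular_set_transversal:
  assumes chart: "\<And>p. p \<in> P \<Longrightarrow> holomorph_chart G M (F p)"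
    and complete: "\<And>\<phi>. holomorph_chart G M \<phi> \<Longrightarrow>
      \<exists>p\<in>P. \<exists>\<alpha>\<in>iso M M. \<forall>d\<in>carrier M. F p d = \<phi> (\<alpha> d)"
    and distinct: "\<And>p p' \<alpha>. p \<in> P \<Longrightarrow> p' \<in> P \<Longrightarrow> \<alpha> \<in> iso M M \<Longrightarrow>
      \<forall>d\<in>carrier M. F p d = F p' (\<alpha> d) \<Longrightarrow> p = p'"
  shows "card (regular_set G M) = card P"
proof -
  have "bij_betw (\<lambda>p. T (F p) ` carrier M) P (regular_set G M)"
  proof (rule bij_betw_imageI)
    show "inj_on (\<lambda>p. T (F p) ` carrier M) P"
    proof (rule inj_onI)
      fix p p' assume p: "p \<in> P" "p' \<in> P" "T (F p) ` carrier M = T (F p') ` carrier M"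
      obtain \<alpha> where "\<alpha> \<in> iso M M" "\<And>d. d \<in> carrier M \<Longrightarrow> F p d = F p' (\<alpha> d)"
        using transport_eq_imp_iso[of "F p'" "F p"] p chart by (metis holomorph_chart_def)
      then show "p = p'" using p distinct by blast
    qed
    show "(\<lambda>p. T (F p) ` carrier M) ` P = regular_set G M"
    proof (intro equalityI subsetI)
      fix N assume "N \<in> regular_set G M"
      then obtain \<phi> where \<phi>: "holomorph_chart G M \<phi>" "N = T \<phi> ` carrier M"
        by (rule regular_set_imp_chart)
      then obtain p \<alpha> where p: "p \<in> P" "\<alpha> \<in> iso M M" "\<And>d. d \<in> carrier M \<Longrightarrow> F p d = \<phi> (\<alpha> d)"
        using complete by blast
      have "T (F p) ` carrier M = N"
        unfolding \<phi>(2) using \<phi>(1) p by (intro transport_comp_iso[of \<phi> \<alpha>]) (auto simp: holomorph_chart_def)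
      then show "N \<in> (\<lambda>p. T (F p) ` carrier M) ` P" using p(1) by blast
    qed (use chart chart_imp_regular_set in auto)
  qed
  then show ?thesis by (simp add: bij_betw_same_card)
qed

end

section \<open>Automorphisms and charts of dihedral groups\<close>

text \<open>
  The bound matters: for \<open>n = 2\<close> the rotations would not be invariant under automorphisms.
\<close>

locale dihedral =
  fixes n :: nat
  assumes n_ge_3: "3 \<le> n"
begin

abbreviation D where "D \<equiv> dihedral_group n"

text \<open>
  The element \<open>x\<^sup>i t\<^sup>s\<close> for an arbitrary integer exponent, so that exponents can be computed with in \<open>\<int>\<close>.
\<close>

definition E :: "int \<Rightarrow> bool \<Rightarrow> int \<times> bool" where
  "E i s = (i mod int n, s)"

sublocale D: group D using n_ge_3 by (intro group_dihedral_group) simp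

sublocale group_pair D D ..

lemma E_in_carrier [simp]: "E i s \<in> carrier D"
  using n_ge_3 by (simp add: E_def dihedral_group_def)

lemma carrierE:
  assumes "p \<in> carrier D"
  obtains i s where "p = E i s"
proof
  show "p = E (fst p) (snd p)" using assms by (auto simp: E_def dihedral_group_def)
qed

lemma ball_carrier_E: "(\<forall>p\<in>carrier D. P p) \<longleftrightarrow> (\<forall>i s. P (E i s))"
  by (metis E_in_carrier carrierE)

lemma E_eq_iff: "E i s = E j t \<longleftrightarrow> int n dvd i - j \<and> s = t"
  by (auto simp: E_def mod_eq_dvd_iff)

lemma E_mult [simp]: "E i s \<otimes>\<^bsub>D\<^esub> E j t = E (if s then i - j else i + j) (s \<noteq> t)"
  by (simp add: E_def dihedral_group_def mod_simps)

lemma E_one: "\<one>\<^bsub>D\<^esub> = E 0 False"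
  by (simp add: E_def dihedral_group_def)

lemma finite_carrier: "finite (carrier D)"
  by (simp add: dihedral_group_def)

definition aut :: "int \<Rightarrow> int \<Rightarrow> int \<times> bool \<Rightarrow> int \<times> bool" where
  "aut u b = (\<lambda>(j, s). E (u * j + (if s then b else 0)) s)"

lemma aut_E: "aut u b (E j s) = E (u * j + (if s then b else 0)) s"
proof -
  have "int n dvd j mod int n - j" by (simp add: mod_eq_dvd_iff[symmetric])
  then have "int n dvd u * (j mod int n - j)" by (rule dvd_mult)
  then show ?thesis unfolding aut_def E_def[of j s] by (simp add: E_eq_iff right_diff_distrib)
qed

lemma aut_iso:
  assumes "coprime u (int n)"
  shows "aut u b \<in> iso D D"
proof (rule isoI)
  have "aut u b (p \<otimes>\<^bsub>D\<^esub> q) = aut u b p \<otimes>\<^bsub>D\<^esub> aut u b q"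
    if "p \<in> carrier D" "q \<in> carrier D" for p q
    using that by (auto elim!: carrierE simp: aut_E algebra_simps)
  moreover have aut_closed: "aut u b ` carrier D \<subseteq> carrier D"
    by (auto elim!: carrierE simp: aut_E)
  ultimately show "aut u b \<in> hom D D" by (auto simp: hom_def)
  have "inj_on (aut u b) (carrier D)"
  proof (rule inj_onI)
    fix p q assume "p \<in> carrier D" "q \<in> carrier D" and eq: "aut u b p = aut u b q"
    then obtain i s j t where pq: "p = E i s" "q = E j t" by (auto elim!: carrierE simp: E_mult)
    then have "s = t" "int n dvd u * (i - j)"
      using eq by (auto simp: aut_E E_eq_iff algebra_simps)
    then show "p = q"
      using assms by (simp add: pq E_eq_iff coprime_dvd_mult_right_iff coprime_commute)
  qed
  then show "bij_betw (aut u b) (carrier D) (carrier D)"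
    using endo_inj_surj[OF finite_carrier aut_closed] by (simp add: bij_betw_def)
qed

lemma coprimeI_multiples:
  assumes "\<And>l. int n dvd l * u \<Longrightarrow> int n dvd l"
  shows "coprime u (int n)"
proof -
  define g where "g = gcd u (int n)"
  have g: "g > 0" using n_ge_3 by (simp add: g_def)
  obtain l where l: "int n = g * l" by (metis g_def gcd_dvd2 dvdE)
  obtain u' where "u = g * u'" by (metis g_def gcd_dvd1 dvdE)
  then have "int n dvd l * u" by (simp add: l)
  then have "int n dvd l" by (rule assms)
  then have "g * l dvd 1 * l" by (simp only: l mult_1)
  moreover have "l \<noteq> 0" using l n_ge_3 by auto
  ultimately have "g dvd 1" by (simp only: dvd_mult_cancel_right) simp
  then show ?thesis using g by (simp add: g_def coprime_iff_gcd_eq_1)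
qed

text \<open>
  The image of \<open>x\<close> is a rotation because the square of a reflection is trivial while \<open>x\<^sup>2\<close> is not;
  then \<open>t\<close> must go to a reflection, for otherwise no reflection would be in the image.
\<close>

lemma iso_aut:
  assumes "\<alpha> \<in> iso D D"
  obtains u b where "coprime u (int n)" "\<And>j s. \<alpha> (E j s) = aut u b (E j s)"
proof -
  have mult: "\<alpha> (p \<otimes>\<^bsub>D\<^esub> q) = \<alpha> p \<otimes>\<^bsub>D\<^esub> \<alpha> q" if "p \<in> carrier D" "q \<in> carrier D" for p q
    using assms that by (simp add: iso_def hom_def)
  have closed: "\<alpha> p \<in> carrier D" if "p \<in> carrier D" for p
    using assms that by (auto simp: iso_def hom_def)
  have bij: "bij_betw \<alpha> (carrier D) (carrier D)" using assms by (simp add: iso_def)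
  have inj: "p = q" if "\<alpha> p = \<alpha> q" "p \<in> carrier D" "q \<in> carrier D" for p q
    using bij that by (auto simp: bij_betw_def inj_on_def)
  have one: "\<alpha> (E 0 False) = E 0 False"
    using hom_one[of \<alpha> D D] assms by (simp add: iso_def E_one)
  obtain u r where ur: "\<alpha> (E 1 False) = E u r"
    using closed[of "E 1 False"] by (auto elim: carrierE)
  obtain b r' where br: "\<alpha> (E 0 True) = E b r'"
    using closed[of "E 0 True"] by (auto elim: carrierE)
  have "\<not> r"
  proof
    assume r
    then have "\<alpha> (E 2 False) = \<alpha> (E 0 False)"
      using mult[of "E 1 False" "E 1 False"] ur one by simp
    then have "int n dvd 2" using inj by (fastforce simp: E_eq_iff)
    then show False using n_ge_3 by (auto dest: zdvd_imp_le)
  qed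
  have rot_nat: "\<alpha> (E (int k) False) = E (u * int k) False" for k
  proof (induction k)
    case (Suc k)
    have "\<alpha> (E (int (Suc k)) False) = \<alpha> (E 1 False) \<otimes>\<^bsub>D\<^esub> \<alpha> (E (int k) False)"
      using mult[of "E 1 False" "E (int k) False"] by (simp add: add.commute)
    then show ?case using Suc ur \<open>\<not> r\<close> by (simp add: algebra_simps)
  qed (simp add: one)
  have rot: "\<alpha> (E j False) = E (u * j) False" for j
  proof -
    have "E j False = E (int (nat (j mod int n))) False"
      using n_ge_3 by (simp add: E_def)
    then have "\<alpha> (E j False) = E (u * (j mod int n)) False"
      using rot_nat[of "nat (j mod int n)"] n_ge_3 by simp
    also have "\<dots> = E (u * j) False" by (simp add: E_def mod_simps)
    finally show ?thesis .
  qed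
  have refl: "\<alpha> (E j True) = E (u * j + b) r'" for j
    using mult[of "E j False" "E 0 True"] by (simp add: rot br)
  have r'
  proof (rule ccontr)
    assume "\<not> r'"
    have "E 0 True \<in> \<alpha> ` carrier D" using bij by (simp add: bij_betw_def)
    then obtain j s where "\<alpha> (E j s) = E 0 True" by (metis carrierE imageE)
    then show False using \<open>\<not> r'\<close> by (cases s) (auto simp: rot refl E_eq_iff)
  qed
  have "coprime u (int n)"
  proof (rule coprimeI_multiples)
    fix l assume "int n dvd l * u"
    then have "\<alpha> (E l False) = \<alpha> (E 0 False)" by (simp add: rot E_eq_iff mult.commute)
    then show "int n dvd l" using inj by (fastforce simp: E_eq_iff)
  qed
  moreover have "\<alpha> (E j s) = aut u b (E j s)" for j s
    using \<open>r'\<close> by (cases s) (auto simp: rot refl aut_E)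
  ultimately show ?thesis using that by blast
qed

text \<open>
  Through \<open>\<phi>\<close>, the element \<open>g\<close> acts by \<open>x\<^sup>j t\<^sup>s \<mapsto> x\<^sup>u\<^sup>j\<^sup>+\<^sup>b t\<^sup>s\<^sup>+\<^sup>e\<close>, where the shift \<open>b\<close> may
  depend on \<open>s\<close>. These are the maps in the holomorph of the dihedral group if \<open>u\<close> is a unit. Only the linear part \<open>u\<close> is
  recorded, since it is multiplicative in \<open>g\<close>.
\<close>

definition acts :: "(int \<times> bool \<Rightarrow> int \<times> bool) \<Rightarrow> int \<times> bool \<Rightarrow> int \<Rightarrow> bool" where
  "acts \<phi> g u \<longleftrightarrow> (\<exists>b e. \<forall>j s. g \<otimes>\<^bsub>D\<^esub> \<phi> (E j s) = \<phi> (E (u * j + b s) (s \<noteq> e)))"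

lemma holomorph_chart_iff:
  "holomorph_chart D D \<phi> \<longleftrightarrow> bij_betw \<phi> (carrier D) (carrier D) \<and> \<phi> (E 0 False) = E 0 False \<and>
     (\<forall>g\<in>carrier D. \<exists>u. coprime u (int n) \<and> acts \<phi> g u)"
proof -
  have "(\<exists>\<alpha>\<in>iso D D. \<exists>h\<in>carrier D. \<forall>d\<in>carrier D. g \<otimes>\<^bsub>D\<^esub> \<phi> d = \<phi> (\<alpha> d \<otimes>\<^bsub>D\<^esub> h)) \<longleftrightarrow>
      (\<exists>u. coprime u (int n) \<and> acts \<phi> g u)" for g
  proof
    assume "\<exists>\<alpha>\<in>iso D D. \<exists>h\<in>carrier D. \<forall>d\<in>carrier D. g \<otimes>\<^bsub>D\<^esub> \<phi> d = \<phi> (\<alpha> d \<otimes>\<^bsub>D\<^esub> h)"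
    then obtain \<alpha> k r where \<alpha>: "\<alpha> \<in> iso D D"
      and eq: "\<And>j s. g \<otimes>\<^bsub>D\<^esub> \<phi> (E j s) = \<phi> (\<alpha> (E j s) \<otimes>\<^bsub>D\<^esub> E k r)"
      by (metis E_in_carrier carrierE)
    from \<alpha> obtain u b where ub: "coprime u (int n)" "\<And>j s. \<alpha> (E j s) = aut u b (E j s)"
      by (rule iso_aut) blast
    have "g \<otimes>\<^bsub>D\<^esub> \<phi> (E j s) = \<phi> (E (u * j + (if s then b - k else k)) (s \<noteq> r))" for j s
      by (simp add: eq ub(2) aut_E algebra_simps)
    then show "\<exists>u. coprime u (int n) \<and> acts \<phi> g u"
      unfolding acts_def by (intro exI[of _ u] conjI ub(1) exI[of _ "\<lambda>s. if s then b - k else k"] exI[of _ r]) auto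
  next
    assume "\<exists>u. coprime u (int n) \<and> acts \<phi> g u"
    then obtain u b e where u: "coprime u (int n)"
      and eq: "\<And>j s. g \<otimes>\<^bsub>D\<^esub> \<phi> (E j s) = \<phi> (E (u * j + b s) (s \<noteq> e))"
      by (auto simp: acts_def)
    have "g \<otimes>\<^bsub>D\<^esub> \<phi> (E j s) = \<phi> (aut u (b True + b False) (E j s) \<otimes>\<^bsub>D\<^esub> E (b False) e)" for j s
      by (cases s) (simp_all add: eq aut_E)
    then show "\<exists>\<alpha>\<in>iso D D. \<exists>h\<in>carrier D. \<forall>d\<in>carrier D. g \<otimes>\<^bsub>D\<^esub> \<phi> d = \<phi> (\<alpha> d \<otimes>\<^bsub>D\<^esub> h)"
      unfolding ball_carrier_E
      by (intro bexI[of _ "aut u (b True + b False)"] bexI[of _ "E (b False) e"] aut_iso u) auto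
  qed
  then show ?thesis by (simp add: holomorph_chart_def E_one)
qed

lemma acts_mult:
  assumes "acts \<phi> g u" "acts \<phi> h v" "g \<in> carrier D" "h \<in> carrier D"
    and \<phi>: "\<phi> ` carrier D \<subseteq> carrier D"
  shows "acts \<phi> (g \<otimes>\<^bsub>D\<^esub> h) (u * v)"
proof -
  obtain b e where g: "\<And>j s. g \<otimes>\<^bsub>D\<^esub> \<phi> (E j s) = \<phi> (E (u * j + b s) (s \<noteq> e))"
    using assms(1) by (auto simp: acts_def)
  obtain c f where h: "\<And>j s. h \<otimes>\<^bsub>D\<^esub> \<phi> (E j s) = \<phi> (E (v * j + c s) (s \<noteq> f))"
    using assms(2) by (auto simp: acts_def)
  have "g \<otimes>\<^bsub>D\<^esub> h \<otimes>\<^bsub>D\<^esub> \<phi> (E j s) = \<phi> (E (u * v * j + (u * c s + b (s \<noteq> f))) (s \<noteq> (f \<noteq> e)))" for j s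
  proof -
    have "\<phi> (E j s) \<in> carrier D" using \<phi> by auto
    then have "g \<otimes>\<^bsub>D\<^esub> h \<otimes>\<^bsub>D\<^esub> \<phi> (E j s) = g \<otimes>\<^bsub>D\<^esub> (h \<otimes>\<^bsub>D\<^esub> \<phi> (E j s))"
      using assms by (simp add: D.m_assoc)
    also have "\<dots> = \<phi> (E (u * v * j + (u * c s + b (s \<noteq> f))) ((s \<noteq> f) \<noteq> e))"
      by (simp add: g h algebra_simps)
    also have "((s \<noteq> f) \<noteq> e) = (s \<noteq> (f \<noteq> e))" by auto
    finally show ?thesis .
  qed
  then show ?thesis
    unfolding acts_def
    by (intro exI[of _ "\<lambda>s. u * c s + b (s \<noteq> f)"] exI[of _ "f \<noteq> e"]) blast
qed

text \<open>
  Any reflection together with \<open>x\<close> generates the group; the freedom in choosing the reflection lets each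
  chart be checked on the one that acts most simply.
\<close>

lemma acts_generators:
  assumes \<phi>: "\<phi> ` carrier D \<subseteq> carrier D"
    and x: "acts \<phi> (E 1 False) u" "coprime u (int n)"
    and r: "acts \<phi> (E i True) v" "coprime v (int n)"
    and g: "g \<in> carrier D"
  shows "\<exists>w. coprime w (int n) \<and> acts \<phi> g w"
proof -
  have rot_nat: "\<exists>w. coprime w (int n) \<and> acts \<phi> (E (int k) False) w" for k
  proof (induction k)
    case 0
    have "acts \<phi> (E 0 False) 1"
      unfolding acts_def
    proof (intro exI allI)
      fix j s
      have "\<phi> (E j s) \<in> carrier D" using \<phi> by auto
      then show "E 0 False \<otimes>\<^bsub>D\<^esub> \<phi> (E j s) = \<phi> (E (1 * j + 0) (s \<noteq> False))"
        by (simp add: E_one[symmetric])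
    qed
    then show ?case by (intro exI[of _ 1]) auto
  next
    case (Suc k)
    then obtain w where w: "coprime w (int n)" "acts \<phi> (E (int k) False) w" by blast
    have "acts \<phi> (E (int (Suc k)) False) (u * w)"
      using acts_mult[OF x(1) w(2) _ _ \<phi>] by simp
    then show ?case using x(2) w(1) by (intro exI[of _ "u * w"]) auto
  qed
  have rot: "\<exists>w. coprime w (int n) \<and> acts \<phi> (E j False) w" for j
  proof -
    have "E j False = E (int (nat (j mod int n))) False"
      using n_ge_3 by (simp add: E_def)
    then show ?thesis using rot_nat by metis
  qed
  obtain j s where js: "g = E j s" using g by (auto elim!: carrierE simp: E_mult)
  show ?thesis
  proof (cases s)
    case True
    obtain w where w: "coprime w (int n)" "acts \<phi> (E (j - i) False) w" using rot by blast
    have "acts \<phi> (E j True) (w * v)"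
      using acts_mult[OF w(2) r(1) _ _ \<phi>] by simp
    then show ?thesis using r(2) w(1) js True by (intro exI[of _ "w * v"]) auto
  qed (use rot js in auto)
qed

lemma coprime_if_square:
  assumes "int n dvd u * u - 1"
  shows "coprime u (int n)"
proof (rule coprimeI_multiples)
  fix l assume "int n dvd l * u"
  then have "int n dvd l * u * u - l * (u * u - 1)" using assms by (intro dvd_diff) auto
  then show "int n dvd l" by (simp add: algebra_simps)
qed

text \<open>
  The image of the rotations under a normalised chart: \<open>x\<^sup>2\<^sup>l\<close> stays fixed and \<open>x\<^sup>2\<^sup>l\<^sup>+\<^sup>1\<close> goes to
  \<open>x\<^sup>2\<^sup>l y\<close>.
\<close>

definition curve :: "int \<times> bool \<Rightarrow> int \<Rightarrow> int \<times> bool" where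
  "curve y j = (if even j then E j False else E (j - 1 + fst y) (snd y))"

text \<open>
  An element outside the curve of \<open>y\<close>, used as the image of \<open>t\<close>.
\<close>

definition base :: "int \<times> bool \<Rightarrow> int \<times> bool" where
  "base y = (if snd y then E 1 False else E 0 True)"

definition chart :: "int \<times> bool \<Rightarrow> int \<Rightarrow> int \<times> bool \<Rightarrow> int \<times> bool" where
  "chart y q = (\<lambda>(j, s). if s then base y \<otimes>\<^bsub>D\<^esub> curve y (q * j) else curve y j)"

text \<open>
  The elements \<open>y\<close> whose curve extends to a holomorph chart. In the rotation case \<open>y = x\<^sup>1\<^sup>+\<^sup>d\<close>,
  translation by \<open>x\<close> multiplies the parameter of the curve by \<open>1 + 2d\<close>; this needs \<open>4d = 0\<close> modulo \<open>n\<close>.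
  The parity condition keeps the two branches of the curve disjoint.
\<close>

definition extendable :: "int \<times> bool \<Rightarrow> bool" where
  "extendable y \<longleftrightarrow> (if snd y then even n
     else int n dvd 4 * (fst y - 1) \<and> even (fst y - 1) \<and> (odd n \<longrightarrow> fst y = 1))"

lemma curve_closed [simp]: "curve y j \<in> carrier D" "base y \<in> carrier D"
  by (auto simp: curve_def base_def)

lemma even_if_dvd: "even n \<Longrightarrow> int n dvd z \<Longrightarrow> even z"
  by (metis dvd_trans even_of_nat_iff)

text \<open>
  For even \<open>n\<close> the parity of \<open>j\<close> can be read off from the point \<open>curve y j\<close>: by its reflection part, or, if
  \<open>y\<close> is a rotation, by the parity of the exponent. For odd \<open>n\<close> the curve is \<open>j \<mapsto> x\<^sup>j\<close>.
\<close>

lemma curve_eq_iff: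
  assumes "extendable y"
  shows "curve y i = curve y j \<longleftrightarrow> int n dvd i - j"
proof (cases "even n")
  case True
  have "even i \<longleftrightarrow> even j" if "int n dvd i - j"
    using even_if_dvd[OF True that] by simp
  moreover have "even i \<longleftrightarrow> even j" if "curve y i = curve y j"
  proof (cases "snd y")
    case True
    then show ?thesis using that by (simp add: curve_def E_eq_iff split: if_splits)
  next
    case False
    then have y: "odd (fst y)" using assms by (simp add: extendable_def)
    have "int n dvd (if even i then i else i - 1 + fst y) - (if even j then j else j - 1 + fst y)"
      using that False by (simp add: curve_def E_eq_iff split: if_splits)
    from even_if_dvd[OF \<open>even n\<close> this] show ?thesis using y by (simp split: if_splits)
  qed
  moreover have "curve y i = curve y j \<longleftrightarrow> int n dvd i - j" if "even i \<longleftrightarrow> even j"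
    using that by (simp add: curve_def E_eq_iff)
  ultimately show ?thesis by blast
next
  case False
  then have "y = (1, False)" using assms by (cases y) (auto simp: extendable_def split: if_splits)
  then show ?thesis by (simp add: curve_def E_eq_iff)
qed

lemma chart_E:
  assumes "extendable y"
  shows "chart y q (E j s) = (if s then base y \<otimes>\<^bsub>D\<^esub> curve y (q * j) else curve y j)"
proof -
  have *: "int n dvd j mod int n - j" by (simp add: mod_eq_dvd_iff[symmetric])
  then have "int n dvd q * (j mod int n) - q * j" unfolding right_diff_distrib[symmetric] by (rule dvd_mult)
  then have "curve y (q * (j mod int n)) = curve y (q * j)" "curve y (j mod int n) = curve y j"
    using * by (simp_all add: curve_eq_iff assms)
  then show ?thesis by (simp add: chart_def E_def)
qed

lemma curve_add_2: "E 2 False \<otimes>\<^bsub>D\<^esub> curve y j = curve y (j + 2)"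
  by (simp add: curve_def algebra_simps)

lemma inverse_rotation_two: "E (-2) False \<otimes>\<^bsub>D\<^esub> curve y j = curve y (j - 2)"
  by (simp add: curve_def algebra_simps)

lemma base_curve_neq_curve:
  assumes "extendable y"
  shows "base y \<otimes>\<^bsub>D\<^esub> curve y i \<noteq> curve y j"
proof (cases "snd y")
  case True
  then have "even n" using assms by (simp add: extendable_def)
  then show ?thesis
    using True even_if_dvd[OF \<open>even n\<close>]
    by (auto simp: base_def curve_def E_eq_iff dest!: even_if_dvd[OF \<open>even n\<close>])
next
  case False
  then show ?thesis by (auto simp: base_def curve_def E_eq_iff)
qed

text \<open>
  It suffices to look at \<open>x\<close> and one reflection. If \<open>y\<close> is a reflection, then \<open>x\<close> exchanges the
  two halves of the chart and \<open>y\<close> reverses each of them. If \<open>y = x\<^sup>1\<^sup>+\<^sup>d\<close>, then \<open>t\<close> exchanges the halves and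
  \<open>x\<close> acts on each with linear part \<open>1 + 2d\<close>, whose square is \<open>1\<close>.
\<close>

lemma chart_is_holomorph_chart:
  assumes "extendable y" and q: "int n dvd q * q - 1"
  shows "holomorph_chart D D (chart y q)"
proof -
  note cE = chart_E[OF assms(1)] and ceq = curve_eq_iff[OF assms(1)]
  have qq: "int n dvd z * (q * q - 1)" for z using q by simp
  have closed: "chart y q ` carrier D \<subseteq> carrier D" by (auto elim!: carrierE simp: cE)
  have "inj_on (chart y q) (carrier D)"
  proof (rule inj_onI)
    fix a b assume "a \<in> carrier D" "b \<in> carrier D" and eq: "chart y q a = chart y q b"
    then obtain i s j t where ab: "a = E i s" "b = E j t" by (auto elim!: carrierE simp: E_mult)
    have st: "s = t"
      using eq base_curve_neq_curve[OF assms(1)] base_curve_neq_curve[OF assms(1), symmetric]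
      by (auto simp: ab cE split: if_splits)
    have "int n dvd i - j"
    proof (cases s)
      case True
      then have "curve y (q * i) = curve y (q * j)" using eq st by (simp add: ab cE)
      then have "int n dvd q * (i - j)" by (simp add: ceq right_diff_distrib)
      then show ?thesis
        using coprime_if_square[OF q] by (simp add: coprime_dvd_mult_right_iff coprime_commute)
    qed (use eq st in \<open>simp add: ab cE ceq\<close>)
    then show "a = b" using st by (simp add: ab E_eq_iff)
  qed
  then have bij: "bij_betw (chart y q) (carrier D) (carrier D)"
    using endo_inj_surj[OF finite_carrier closed] by (simp add: bij_betw_def)
  have "\<exists>w. coprime w (int n) \<and> acts (chart y q) g w" if g: "g \<in> carrier D" for g
  proof (cases "snd y")
    case True
    define a where "a = fst y"
    have cy: "curve y j = (if even j then E j False else E (j - 1 + a) True)" for j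
      using True by (simp add: curve_def a_def)
    have x: "acts (chart y q) (E 1 False) q"
      unfolding acts_def
    proof (intro exI allI)
      fix j s
      have "curve y (q * (q * j)) = curve y j"
        using qq[of j] by (simp add: ceq algebra_simps)
      moreover have "E 1 False \<otimes>\<^bsub>D\<^esub> (E 1 False \<otimes>\<^bsub>D\<^esub> curve y (q * j)) = curve y (q * j + 2)"
        using curve_add_2[of y "q * j"] by (simp add: D.m_assoc[symmetric])
      ultimately show "E 1 False \<otimes>\<^bsub>D\<^esub> chart y q (E j s) = chart y q (E (q * j + (if s then 2 else 0)) (s \<noteq> True))"
        by (simp add: cE base_def True)
    qed
    have flip: "E a True \<otimes>\<^bsub>D\<^esub> curve y j = curve y (1 - j)" for j
      by (simp add: cy)
    have r: "acts (chart y q) (E a True) (-1)"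
      unfolding acts_def
    proof (intro exI allI)
      fix j s
      have "E a True \<otimes>\<^bsub>D\<^esub> (E 1 False \<otimes>\<^bsub>D\<^esub> curve y (q * j)) = E 1 False \<otimes>\<^bsub>D\<^esub> (E (-2) False \<otimes>\<^bsub>D\<^esub> (E a True \<otimes>\<^bsub>D\<^esub> curve y (q * j)))"
        by (simp add: D.m_assoc[symmetric])
      also have "\<dots> = E 1 False \<otimes>\<^bsub>D\<^esub> curve y (- 1 - q * j)"
        by (simp add: flip inverse_rotation_two)
      also have "curve y (- 1 - q * j) = curve y (q * (- q - j))"
        using qq[of 1] by (simp add: ceq algebra_simps)
      finally show "E a True \<otimes>\<^bsub>D\<^esub> chart y q (E j s) = chart y q (E (-1 * j + (if s then - q else 1)) (s \<noteq> False))"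
        by (simp add: cE base_def True flip)
    qed
    show ?thesis
      by (rule acts_generators[OF closed x coprime_if_square[OF q] r _ g]) simp
  next
    case False
    define d where "d = fst y - 1"
    have d: "int n dvd 4 * d" "even d" using assms(1) False by (auto simp: extendable_def d_def)
    have cy: "curve y j = E (j + (if odd j then d else 0)) False" for j
      using False by (simp add: curve_def d_def algebra_simps)
    have dd: "int n dvd 4 * d * z" for z using d(1) by (rule dvd_mult2)
    have t: "acts (chart y q) (E 0 True) q"
      unfolding acts_def
    proof (intro exI allI)
      fix j s
      have "curve y (q * (q * j)) = curve y j"
        using qq[of j] by (simp add: ceq algebra_simps)
      moreover have "E 0 True \<otimes>\<^bsub>D\<^esub> (E 0 True \<otimes>\<^bsub>D\<^esub> curve y (q * j)) = curve y (q * j)"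
        by (simp add: cy add.commute)
      ultimately show "E 0 True \<otimes>\<^bsub>D\<^esub> chart y q (E j s) = chart y q (E (q * j + 0) (s \<noteq> True))"
        by (simp add: cE base_def False)
    qed
    have step: "E 1 False \<otimes>\<^bsub>D\<^esub> curve y j = curve y ((1 + 2 * d) * j + (1 - d))"
      "E (-1) False \<otimes>\<^bsub>D\<^esub> curve y j = curve y ((1 + 2 * d) * j - (1 + d))" for j
    proof -
      obtain m where m: "j = 2 * m \<or> j = 2 * m + 1" by (metis evenE oddE)
      obtain d' where d': "d = 2 * d'" using d(2) by (rule evenE)
      have "int n dvd 4 * d * m" "int n dvd - (4 * d * m)" using dd by auto
      then show "E 1 False \<otimes>\<^bsub>D\<^esub> curve y j = curve y ((1 + 2 * d) * j + (1 - d))"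
        "E (-1) False \<otimes>\<^bsub>D\<^esub> curve y j = curve y ((1 + 2 * d) * j - (1 + d))"
        using m by (auto simp: cy d' E_eq_iff algebra_simps)
    qed
    have x: "acts (chart y q) (E 1 False) (1 + 2 * d)"
      unfolding acts_def
    proof (intro exI allI)
      fix j s
      have "E 1 False \<otimes>\<^bsub>D\<^esub> (E 0 True \<otimes>\<^bsub>D\<^esub> curve y (q * j)) = E 0 True \<otimes>\<^bsub>D\<^esub> (E (-1) False \<otimes>\<^bsub>D\<^esub> curve y (q * j))"
        by (simp add: D.m_assoc[symmetric])
      also have "\<dots> = E 0 True \<otimes>\<^bsub>D\<^esub> curve y ((1 + 2 * d) * (q * j) - (1 + d))"
        by (simp only: step)
      also have "curve y ((1 + 2 * d) * (q * j) - (1 + d)) = curve y (q * ((1 + 2 * d) * j + - q * (1 + d)))"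
        using qq[of "1 + d"] by (simp add: ceq algebra_simps)
      finally show "E 1 False \<otimes>\<^bsub>D\<^esub> chart y q (E j s) = chart y q (E ((1 + 2 * d) * j + (if s then - q * (1 + d) else 1 - d)) (s \<noteq> False))"
        by (simp add: cE base_def False step(1))
    qed
    have "int n dvd (1 + 2 * d) * (1 + 2 * d) - 1"
      using dd[of "1 + d"] by (simp add: algebra_simps)
    then have "coprime (1 + 2 * d) (int n)" by (rule coprime_if_square)
    then show ?thesis
      by (rule acts_generators[OF closed x _ t coprime_if_square[OF q] g])
  qed
  moreover have "chart y q (E 0 False) = E 0 False" by (simp add: cE curve_def)
  ultimately show ?thesis using bij by (simp add: holomorph_chart_iff)
qed

lemma E_fst_snd: "p \<in> carrier D \<Longrightarrow> E (fst p) (snd p) = p"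
  by (auto simp: E_def dihedral_group_def)

lemma fst_bounds: "p \<in> carrier D \<Longrightarrow> 0 \<le> fst p \<and> fst p < int n"
  by (auto simp: dihedral_group_def)

lemma dvd_coprime_cancel: "coprime w (int n) \<Longrightarrow> int n dvd w * z \<longleftrightarrow> int n dvd z"
  by (simp add: coprime_dvd_mult_right_iff coprime_commute)

text \<open>
  The hypothesis says that \<open>r\<close> and \<open>2\<close> have the same additive order modulo \<open>n\<close>, so they differ by a unit.
  For even \<open>n\<close>, the two halves \<open>r/2\<close> and \<open>r/2 + n/2\<close> are candidates, and at least one of them
  is prime to \<open>n\<close>.
\<close>

lemma unit_halving:
  assumes "\<And>l. int n dvd l * r \<longleftrightarrow> int n dvd 2 * l"
  obtains w where "coprime w (int n)" "int n dvd 2 * w - r"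
proof (cases "even n")
  case True
  then obtain m where m: "int n = 2 * m" by (metis even_of_nat_iff evenE)
  have m0: "m > 0" using m n_ge_3 by simp
  have "2 * m dvd m * r" using assms[of m] m by simp
  then have "even r" using m0 by (metis dvd_mult_cancel_left less_irrefl mult.commute)
  then obtain r' where r': "r = 2 * r'" by (rule evenE)
  have "coprime r' m"
  proof -
    define g where "g = gcd r' m"
    obtain l where l: "m = g * l" by (metis g_def gcd_dvd2 dvdE)
    obtain r'' where "r' = g * r''" by (metis g_def gcd_dvd1 dvdE)
    then have "int n dvd l * r" by (simp add: m l r')
    then have "g * l dvd 1 * l" using assms[of l] m l by simp
    moreover have "l \<noteq> 0" using l m0 by auto
    ultimately have "g dvd 1" by (simp only: dvd_mult_cancel_right) simp
    then show ?thesis unfolding g_def by (simp add: coprime_iff_gcd_eq_1)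
  qed
  show ?thesis
  proof (cases "even r'")
    case True
    then have "odd m" using \<open>coprime r' m\<close> by (metis coprime_common_divisor odd_one)
    then have "coprime (r' + m) (int n)"
      using True \<open>coprime r' m\<close> by (simp add: m coprime_iff_gcd_eq_1[of _ m])
    moreover have "int n dvd 2 * (r' + m) - r" by (simp add: m r')
    ultimately show ?thesis by (rule that)
  next
    case False
    then have "coprime r' (int n)" using \<open>coprime r' m\<close> by (simp add: m)
    then show ?thesis using that[of r'] by (simp add: r')
  qed
next
  case False
  then obtain k where k: "int n = 2 * k + 1" by (metis even_of_nat_iff oddE)
  define w where "w = r * (k + 1)"
  have w: "2 * w - r = int n * r" by (simp add: w_def k algebra_simps)
  have odd_dvd: "int n dvd l" if "int n dvd 2 * l" for l
  proof -
    have "int n dvd (k + 1) * (2 * l) - int n * l" using that by simp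
    then show ?thesis by (simp add: k algebra_simps)
  qed
  have "coprime w (int n)"
  proof (rule coprimeI_multiples)
    fix l assume "int n dvd l * w"
    then have "int n dvd 2 * (l * w) - l * (2 * w - r)" by (simp add: w)
    then have "int n dvd l * r" by (simp add: algebra_simps)
    then have "int n dvd 2 * l" by (simp only: assms)
    then show "int n dvd l" by (rule odd_dvd)
  qed
  then show ?thesis using w that by simp
qed

section \<open>Representatives\<close>

text \<open>
  One element from each orbit of \<open>y \<mapsto> x\<^sup>n\<^sup>/\<^sup>2 y\<close> on the extendable elements when \<open>4\<close> divides \<open>n\<close>; all extendable elements
  otherwise.
\<close>

definition reps :: "(int \<times> bool) set" where
  "reps = {0..<(if odd n then 0 else if 4 dvd n then int (n div 2) else int n)} \<times> {True} \<union>
     {(1, False)} \<union> (if 8 dvd n then {(1 + int (n div 4), False)} else {})"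

definition involutions :: "int set" where
  "involutions = {q \<in> {0..<int n}. int n dvd q * q - 1}"

lemma reps_carrier: "y \<in> reps \<Longrightarrow> y \<in> carrier D"
  using n_ge_3 by (auto simp: reps_def dihedral_group_def split: if_splits)

lemma reps_extendable:
  assumes "y \<in> reps"
  shows "extendable y"
proof -
  consider "snd y" "even n" | "y = (1, False)" | "8 dvd n" "y = (1 + int (n div 4), False)"
    using assms by (auto simp: reps_def split: if_splits)
  then show ?thesis
  proof cases
    case 3
    then obtain k where k: "n = 8 * k" by (metis dvdE)
    then have "int n dvd 4 * int (n div 4)" "even (int (n div 4))" "even n" by simp_all
    then show ?thesis by (simp add: extendable_def 3(2))
  qed (auto simp: extendable_def)
qed

text \<open>
  Distinctness of representatives: no two of them differ by the factor \<open>x\<^sup>n\<^sup>/\<^sup>2\<close>.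
\<close>

lemma reps_close:
  assumes "4 dvd n" "y \<in> reps" "y' \<in> reps" "snd y = snd y'"
  shows "\<bar>fst y - fst y'\<bar> < int (n div 2)"
proof -
  obtain k where k: "n = 4 * k" using assms(1) by (rule dvdE)
  then have half: "int (n div 2) = 2 * int k" "int (n div 4) = int k" and "int k > 0"
    using n_ge_3 by simp_all
  have z: "if snd z then 0 \<le> fst z \<and> fst z < 2 * int k else fst z = 1 \<or> fst z = 1 + int k"
    if "z \<in> reps" for z
    using that assms(1) half by (auto simp: reps_def split: if_splits)
  show ?thesis
    using z[OF assms(2)] z[OF assms(3)] assms(4) \<open>int k > 0\<close> by (auto simp: half split: if_splits)
qed

text \<open>
  For rotations with \<open>n = 4k\<close>, the condition \<open>4d = 0\<close> leaves \<open>d \<in> {0, k, 2k, 3k}\<close>; the odd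
  multiples of \<open>k\<close> are even only if \<open>8\<close> divides \<open>n\<close>, and adding \<open>2k\<close> pairs them up.
\<close>

lemma extendable_reps:
  assumes "extendable y" "y \<in> carrier D"
  shows "y \<in> reps \<or> (4 dvd n \<and> E (int (n div 2) + fst y) (snd y) \<in> reps)"
proof -
  obtain a s where y: "y = (a, s)" by (cases y)
  have a: "0 \<le> a" "a < int n" using fst_bounds[OF assms(2)] y by auto
  show ?thesis
  proof (cases s)
    case True
    then have "even n" using assms(1) y by (simp add: extendable_def)
    show ?thesis
    proof (cases "4 dvd n \<and> int (n div 2) \<le> a")
      case True
      then obtain k where k: "n = 4 * k" by (metis dvdE)
      then have half: "int n = 2 * int (n div 2)" by simp
      then have "(int (n div 2) + a) mod int n = (a - int (n div 2)) mod int n"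
        using minus_mod_self2[of "int (n div 2) + a" "int n"] by simp
      also have "\<dots> = a - int (n div 2)" using a True by (intro mod_pos_pos_trivial) linarith+
      finally have "E (int (n div 2) + fst y) (snd y) = (a - int (n div 2), True)"
        using y \<open>s\<close> by (simp add: E_def)
      also have "\<dots> \<in> reps" using a True half \<open>even n\<close> by (simp add: reps_def)
      finally show ?thesis using True by simp
    next
      case False
      then show ?thesis using a y \<open>s\<close> \<open>even n\<close> by (auto simp: reps_def)
    qed
  next
    case False
    then have d: "int n dvd 4 * (a - 1)" "even (a - 1)" "odd n \<Longrightarrow> a = 1"
      using assms(1) y by (simp_all add: extendable_def)
    have d0: "0 \<le> a - 1" using a d(2) by presburger
    have "odd n \<or> (\<exists>m. n = 2 * m \<and> odd m) \<or> (\<exists>k. n = 4 * k)" by presburger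
    then consider "odd n" | m where "n = 2 * m" "odd m" | k where "n = 4 * k" by blast
    then show ?thesis
    proof cases
      case 1
      then show ?thesis using d(3) y False by (simp add: reps_def)
    next
      case (2 m)
      have "2 * int m dvd 2 * (2 * (a - 1))" using d(1) by (simp add: 2(1))
      then have "int m dvd 2 * (a - 1)" by (simp only: dvd_mult_cancel_left) simp
      moreover have "coprime (int m) 2" using \<open>odd m\<close> by simp
      ultimately have "int m dvd a - 1" by (simp only: coprime_dvd_mult_right_iff)
      then have "2 * int m dvd a - 1" using d(2) \<open>coprime (int m) 2\<close>
        by (intro divides_mult) (auto simp: coprime_commute)
      then have "int n dvd a - 1" by (simp add: 2)
      then have "a = 1" using a d0 by (auto dest: zdvd_imp_le)
      then show ?thesis using y False by (simp add: reps_def)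
    next
      case 3
      then have "4 * int k dvd 4 * (a - 1)" using d(1) by simp
      then have "int k dvd a - 1" by (simp only: dvd_mult_cancel_left) simp
      then obtain c where c: "a - 1 = int k * c" by (rule dvdE)
      have k0: "int k > 0" using 3 n_ge_3 by simp
      have four: "4 dvd n" and n4: "int n = int k * 4"
        and div: "int (n div 2) = 2 * int k" "int (n div 4) = int k"
        using 3 by simp_all
      have eight: "8 dvd n" if "even k" using that 3 by (auto elim!: evenE)
      have "int k * c < int k * 4" "int k * 0 \<le> int k * c" using a d0 c n4 by linarith+
      then have "c < 4" "0 \<le> c" using k0 by (simp_all only: mult_less_cancel_left_pos mult_le_cancel_left_pos)
      then consider "c = 0" | "c = 1" | "c = 2" | "c = 3" by linarith
      then show ?thesis
      proof cases
        case 1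
        then show ?thesis using c y False by (simp add: reps_def)
      next
        case 2
        then have "8 dvd n" using c d(2) eight by simp
        moreover have "a = 1 + int k" using c 2 by simp
        ultimately show ?thesis using y False by (simp add: reps_def div)
      next
        case 3
        have "int (n div 2) + a - 1 = int n" using c n4 div unfolding 3 by linarith
        then have "int n dvd int (n div 2) + a - 1" by (simp only: dvd_refl)
        then have "E (int (n div 2) + a) False = E 1 False" by (simp only: E_eq_iff simp_thms)
        then show ?thesis using four y False n_ge_3 by (simp add: E_def reps_def)
      next
        case 4
        then have "8 dvd n" using c d(2) eight by simp
        have "int (n div 2) + a - (1 + int k) = int n" using c n4 div unfolding 4 by linarith
        then have "int n dvd int (n div 2) + a - (1 + int k)" by (simp only: dvd_refl)
        then have "E (int (n div 2) + a) False = E (1 + int k) False" by (simp only: E_eq_iff simp_thms)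
        moreover have "(1 + int k) mod int n = 1 + int k" using k0 n4 by (intro mod_pos_pos_trivial) auto
        ultimately show ?thesis using four \<open>8 dvd n\<close> y False by (simp add: E_def reps_def div)
      qed
    qed
  qed
qed

lemma involutions_eq_Upsilon: "involutions = Upsilon n"
proof -
  interpret R: residues "int n" "residue_ring (int n)"
    using n_ge_3 by unfold_locales auto
  have "int n dvd q * q - 1 \<longleftrightarrow> q ^ 2 mod int n = 1" for q
    using n_ge_3 mod_eq_dvd_iff[of "q * q" "int n" 1] by (simp add: power2_eq_square)
  moreover have "q [^]\<^bsub>residue_ring (int n)\<^esub> (2::nat) = q ^ 2 mod int n" if "0 \<le> q" "q < int n" for q
    using R.pow_cong[of q 2] that by simp
  moreover have "0 < q" if "int n dvd q * q - 1" "0 \<le> q" for q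
    using that n_ge_3 by (cases "q = 0") auto
  ultimately show ?thesis
    unfolding involutions_def Upsilon_def R.res_units_eq R.res_one_eq
    using coprime_if_square by auto
qed

lemma card_reps:
  "card reps = (if odd n then 1 else (if 4 dvd n then n div 2 else n) + 1 + (if 8 dvd n then 1 else 0))"
proof -
  define A where "A = {0..<(if odd n then 0 else if 4 dvd n then int (n div 2) else int n)} \<times> {True}"
  define C where "C = (if 8 dvd n then {(1 + int (n div 4), False)} else {})"
  have "reps = A \<union> insert (1, False) C" by (simp add: reps_def A_def C_def)
  moreover have "card (insert (1, False) C) = 1 + (if 8 dvd n then 1 else 0)"
    using n_ge_3 by (auto simp: C_def)
  moreover have "card (A \<union> insert (1, False) C) = card A + card (insert (1, False) C)"
    by (rule card_Un_disjoint) (auto simp: A_def C_def)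
  moreover have "card A = (if odd n then 0 else if 4 dvd n then n div 2 else n)"
    by (simp add: A_def card_cartesian_product)
  moreover have "odd n \<Longrightarrow> \<not> 8 dvd n" using dvd_trans[of 2 8 n] by auto
  ultimately show ?thesis by auto
qed

text \<open>
  An automorphism relating two charts reparametrises the curves by a unit \<open>w\<close>, and the common point \<open>x\<^sup>2\<close>
  forces \<open>2w = 2\<close>. If \<open>w\<close> were \<open>1 + n/2\<close>, then \<open>y\<close> and \<open>y'\<close> would differ by \<open>x\<^sup>n\<^sup>/\<^sup>2\<close>; so the curves agree,
  and then so do the speeds on the other half.
\<close>

lemma chart_distinct:
  assumes y: "y \<in> reps" "y' \<in> reps" and q: "q \<in> involutions" "q' \<in> involutions"
    and \<alpha>: "\<alpha> \<in> iso D D"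
    and eq: "\<forall>d\<in>carrier D. chart y q d = chart y' q' (\<alpha> d)"
  shows "y = y' \<and> q = q'"
proof -
  note extendable = reps_extendable[OF y(1)] reps_extendable[OF y(2)]
  note cE = chart_E[OF extendable(1)] chart_E[OF extendable(2)]
  from \<alpha> obtain w b where w: "coprime w (int n)" and \<alpha>_E: "\<And>j s. \<alpha> (E j s) = aut w b (E j s)"
    by (rule iso_aut) blast
  have eq: "chart y q (E j s) = chart y' q' (E (w * j + (if s then b else 0)) s)" for j s
    using eq by (simp add: \<alpha>_E aut_E)
  have rot: "curve y j = curve y' (w * j)" for j
    using eq[of j False] by (simp add: cE)
  have refl: "base y \<otimes>\<^bsub>D\<^esub> curve y (q * j) = base y' \<otimes>\<^bsub>D\<^esub> curve y' (q' * (w * j + b))" for j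
    using eq[of j True] by (simp add: cE)
  have curve_1: "curve z 1 = z" if "z \<in> reps" for z
    using E_fst_snd[OF reps_carrier[OF that]] by (simp add: curve_def)
  have w2: "int n dvd 2 * (w - 1)"
    using rot[of 2] by (simp add: curve_def E_eq_iff dvd_diff_commute algebra_simps)
  have w1: "int n dvd w - 1"
  proof (cases "even n")
    case True
    then obtain m where m: "n = 2 * m" by (rule evenE)
    then have "2 * int m dvd 2 * (w - 1)" using w2 by (simp only: of_nat_mult of_nat_numeral)
    then have "int m dvd w - 1" by (simp only: dvd_mult_cancel_left) simp
    then obtain c where c: "w - 1 = int m * c" by (rule dvdE)
    show ?thesis
    proof (cases "even c")
      case True
      then show ?thesis by (auto simp: c m elim!: evenE)
    next
      case False
      then obtain c' where c': "c = 2 * c' + 1" by (rule oddE)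
      have "odd w" using w m by simp
      then have "even (w - 1)" by simp
      then have "even m" using False by (simp add: c)
      then have "4 dvd n" by (auto simp: m elim!: evenE)
      have "y = curve y' w" using rot[of 1] curve_1[OF y(1)] by simp
      also have "\<dots> = E (w - 1 + fst y') (snd y')" using \<open>odd w\<close> by (simp add: curve_def)
      finally have "E (fst y) (snd y) = E (w - 1 + fst y') (snd y')"
        using E_fst_snd[OF reps_carrier[OF y(1)]] by simp
      then have "snd y = snd y'" and "int n dvd fst y - (w - 1 + fst y')"
        by (simp_all add: E_eq_iff)
      then have "int n dvd fst y - (w - 1 + fst y') + int n * c'" by simp
      then have "int n dvd int m + fst y' - fst y"
        by (subst dvd_minus_iff[symmetric]) (simp add: c c' m algebra_simps)
      moreover have "\<bar>fst y - fst y'\<bar> < int m"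
        using reps_close[OF \<open>4 dvd n\<close> y \<open>snd y = snd y'\<close>] m by simp
      ultimately show ?thesis using m by (auto dest: zdvd_imp_le)
    qed
  next
    case False
    then have "coprime (int n) 2" by simp
    then show ?thesis using w2 by (simp only: coprime_dvd_mult_right_iff)
  qed
  have "y = curve y' w" using rot[of 1] curve_1[OF y(1)] by simp
  also have "\<dots> = curve y' 1" using w1 by (simp add: curve_eq_iff extendable)
  finally have yy: "y = y'" using curve_1[OF y(2)] by simp
  have refl: "int n dvd q * j - q' * (w * j + b)" for j
    using refl[of j] by (simp add: yy curve_eq_iff extendable)
  have "int n dvd q' * (w - 1)" using w1 by simp
  then have "int n dvd (q * 1 - q' * (w * 1 + b)) - (q * 0 - q' * (w * 0 + b)) + q' * (w - 1)"
    by (intro dvd_add dvd_diff refl)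
  then have "int n dvd q - q'" by (simp add: algebra_simps)
  then have "q mod int n = q' mod int n" by (simp add: mod_eq_dvd_iff)
  then show ?thesis using yy q by (simp add: involutions_def)
qed

end

section \<open>Normal form of a chart\<close>

locale dihedral_chart = dihedral +
  fixes \<phi> :: "int \<times> bool \<Rightarrow> int \<times> bool"
  assumes holomorph_chart: "holomorph_chart D D \<phi>"
begin

lemma chart_bij: "bij_betw \<phi> (carrier D) (carrier D)"
  and chart_one: "\<phi> (E 0 False) = E 0 False"
  and chart_acts: "g \<in> carrier D \<Longrightarrow> \<exists>u. coprime u (int n) \<and> acts \<phi> g u"
  using holomorph_chart by (auto simp: holomorph_chart_iff)

lemma chart_image: "\<phi> ` carrier D \<subseteq> carrier D"
  using chart_bij by (simp add: bij_betw_def)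

lemma chart_closed [simp]: "\<phi> (E j s) \<in> carrier D"
  using chart_image by auto

lemma chart_eq_iff: "\<phi> (E i s) = \<phi> (E j t) \<longleftrightarrow> int n dvd i - j \<and> s = t"
  using inj_on_eq_iff[OF bij_betw_imp_inj_on[OF chart_bij], of "E i s" "E j t"] by (simp add: E_eq_iff)

text \<open>
  Linear parts are determined modulo \<open>n\<close>, which makes the linear part a well-defined homomorphism.
\<close>

lemma acts_one:
  assumes "acts \<phi> (E 0 False) u"
  shows "int n dvd u - 1"
proof -
  obtain b e where be: "\<And>j s. E 0 False \<otimes>\<^bsub>D\<^esub> \<phi> (E j s) = \<phi> (E (u * j + b s) (s \<noteq> e))"
    using assms by (auto simp: acts_def)
  then have "\<phi> (E j False) = \<phi> (E (u * j + b False) e)" for j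
    using be[of j False] by (simp add: E_one[symmetric])
  then have "int n dvd j - (u * j + b False)" for j by (simp add: chart_eq_iff)
  from dvd_diff[OF this[of 0] this[of 1]] show ?thesis by simp
qed

lemma acts_reflection:
  assumes "acts \<phi> (E i True) u"
  shows "int n dvd u * u - 1"
  using acts_mult[OF assms assms _ _ chart_image] by (intro acts_one) simp

text \<open>
  Both \<open>t\<close> and \<open>xt\<close> are involutions, so the linear part of \<open>x\<close> is a product of two commuting involutions.
\<close>

lemma acts_rotation_one:
  assumes "acts \<phi> (E 1 False) u"
  shows "int n dvd u * u - 1"
proof -
  obtain v where v: "acts \<phi> (E 0 True) v" using chart_acts[of "E 0 True"] by auto
  have "acts \<phi> (E 1 True) (u * v)"
    using acts_mult[OF assms v _ _ chart_image] by simp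
  then have "int n dvd (u * v * (u * v) - 1) - u * u * (v * v - 1)"
    using acts_reflection[OF v] by (intro dvd_diff acts_reflection) auto
  then show ?thesis by (simp add: algebra_simps)
qed

lemma acts_base: "acts \<phi> (base y) u \<Longrightarrow> int n dvd u * u - 1"
  by (auto simp: base_def acts_reflection acts_rotation_one split: if_splits)

text \<open>
  Translation by \<open>x\<^sup>2\<close> preserves the curve \<open>j \<mapsto> \<phi>(x\<^sup>j)\<close> and has linear part \<open>1\<close>, so it is a shift
  by some \<open>r\<close>. Faithfulness gives \<open>r\<close> the same order as \<open>2\<close>, and a unit rescales it to \<open>2\<close>.
\<close>

lemma obtain_curve:
  obtains w y where "coprime w (int n)" "y \<in> carrier D" "\<And>j. \<phi> (E (w * j) False) = curve y j"
proof -
  obtain u where u: "acts \<phi> (E 1 False) u" using chart_acts[of "E 1 False"] by auto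
  then obtain b e where be: "\<And>j s. E 1 False \<otimes>\<^bsub>D\<^esub> \<phi> (E j s) = \<phi> (E (u * j + b s) (s \<noteq> e))"
    by (auto simp: acts_def)
  define r where "r = u * b False + b e"
  have two: "E 2 False \<otimes>\<^bsub>D\<^esub> \<phi> (E j False) = \<phi> (E (j + r) False)" for j
  proof -
    have "E 2 False \<otimes>\<^bsub>D\<^esub> \<phi> (E j False) = E 1 False \<otimes>\<^bsub>D\<^esub> (E 1 False \<otimes>\<^bsub>D\<^esub> \<phi> (E j False))"
      by (simp add: D.m_assoc[symmetric])
    also have "\<dots> = \<phi> (E (u * (u * j + b False) + b e) False)" by (simp add: be)
    also have "\<dots> = \<phi> (E (j + r) False)"
      using dvd_mult[OF acts_rotation_one[OF u], of j] by (simp add: chart_eq_iff r_def algebra_simps)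
    finally show ?thesis .
  qed
  have even_nat: "E (2 * int l) False \<otimes>\<^bsub>D\<^esub> \<phi> (E j False) = \<phi> (E (j + int l * r) False)" for l j
  proof (induction l)
    case 0
    then show ?case by (simp add: E_one[symmetric])
  next
    case (Suc l)
    have "E (2 * int (Suc l)) False \<otimes>\<^bsub>D\<^esub> \<phi> (E j False) =
        E 2 False \<otimes>\<^bsub>D\<^esub> (E (2 * int l) False \<otimes>\<^bsub>D\<^esub> \<phi> (E j False))"
      by (simp add: D.m_assoc[symmetric])
    also have "\<dots> = \<phi> (E (j + int l * r + r) False)" by (simp only: Suc two)
    finally show ?case by (simp add: algebra_simps)
  qed
  have even: "E (2 * l) False \<otimes>\<^bsub>D\<^esub> \<phi> (E j False) = \<phi> (E (j + l * r) False)" for l j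
  proof -
    define k where "k = nat (l mod int n)"
    have k: "int n dvd l - int k" using n_ge_3 by (simp add: k_def mod_eq_dvd_iff[symmetric])
    have "int n dvd 2 * (l - int k)" "int n dvd (l - int k) * r"
      using dvd_mult[OF k] dvd_mult2[OF k] by blast+
    then have "E (2 * l) False = E (2 * int k) False" "\<phi> (E (j + l * r) False) = \<phi> (E (j + int k * r) False)"
      by (simp_all add: E_eq_iff chart_eq_iff algebra_simps)
    then show ?thesis by (simp add: even_nat)
  qed
  have even_one: "E (2 * l) False = \<phi> (E (l * r) False)" for l
    using even[of l 0] by (simp add: chart_one)
  have "int n dvd l * r \<longleftrightarrow> int n dvd 2 * l" for l
    using chart_eq_iff[of "l * r" False 0 False] by (simp add: even_one[symmetric] chart_one E_eq_iff)
  then obtain w where w: "coprime w (int n)" "int n dvd 2 * w - r"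
    by (rule unit_halving) blast
  define y where "y = \<phi> (E w False)"
  have y: "y \<in> carrier D" by (simp add: y_def)
  have "\<phi> (E (w * j) False) = curve y j" for j
  proof (cases "even j")
    case True
    then obtain l where l: "j = 2 * l" by (rule evenE)
    have "int n dvd l * (2 * w - r)" using w(2) by (rule dvd_mult)
    then have "\<phi> (E (w * j) False) = \<phi> (E (l * r) False)" by (simp add: chart_eq_iff l algebra_simps)
    then show ?thesis using True l by (simp add: curve_def even_one)
  next
    case False
    then obtain l where l: "j = 2 * l + 1" by (rule oddE)
    have "int n dvd l * (2 * w - r)" using w(2) by (rule dvd_mult)
    then have "\<phi> (E (w * j) False) = \<phi> (E (w + l * r) False)" by (simp add: chart_eq_iff l algebra_simps)
    also have "\<dots> = E (2 * l) False \<otimes>\<^bsub>D\<^esub> E (fst y) (snd y)" 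
      using E_fst_snd[OF y] by (simp add: even[symmetric] y_def)
    finally show ?thesis using l by (simp add: curve_def)
  qed
  then show ?thesis using that w(1) y by blast
qed

text \<open>
  For odd \<open>n\<close> the curve must close up after \<open>n\<close> steps. For even \<open>n\<close> and a rotation \<open>y = x\<^sup>a\<close>, the point
  \<open>x\<close> has parameter \<open>2 - a\<close>; comparing the action of \<open>x\<close> at the parameters \<open>0\<close>, \<open>1\<close> and \<open>2 - a\<close>
  gives \<open>u = 2a - 1\<close> and \<open>2a(2 - a) = 2\<close>, which together with \<open>u\<^sup>2 = 1\<close> yield \<open>4(a - 1) = 0\<close> modulo \<open>n\<close>.
\<close>

lemma curve_extendable:
  assumes w: "coprime w (int n)" and y: "y \<in> carrier D" and cy: "\<And>j. \<phi> (E (w * j) False) = curve y j"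
  shows "extendable y"
proof -
  have eq: "curve y i = curve y j \<longleftrightarrow> int n dvd i - j" for i j
    using dvd_coprime_cancel[OF w, of "i - j"]
    by (simp add: cy[symmetric] chart_eq_iff right_diff_distrib)
  define a where "a = fst y"
  have a: "0 \<le> a" "a < int n" using fst_bounds[OF y] by (simp_all add: a_def)
  show ?thesis
  proof (cases "odd n")
    case True
    have "curve y (int n) = curve y 0" by (simp add: eq)
    then have "\<not> snd y" "int n dvd int n - 1 + a"
      using True by (simp_all add: curve_def a_def E_eq_iff)
    moreover have "int n dvd (int n - 1 + a) - int n"
      using \<open>int n dvd int n - 1 + a\<close> by (rule dvd_diff) simp
    then have "int n dvd a - 1" by simp
    then have "a = 1" using a n_ge_3 by (cases "a = 0") (auto dest: zdvd_imp_le)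
    ultimately show ?thesis using a_def by (simp add: extendable_def)
  next
    case False
    then have n: "even n" by simp
    show ?thesis
    proof (cases "snd y")
      case True
      then show ?thesis using n by (simp add: extendable_def)
    next
      case False
      have cj: "curve y j = E (if even j then j else j - 1 + a) False" for j
        using False by (simp add: curve_def a_def)
      have "odd a"
      proof
        assume "even a"
        then have "curve y a = curve y 1" by (simp add: cj)
        then have "even (a - 1)" using even_if_dvd[OF n] eq by blast
        then show False using \<open>even a\<close> by simp
      qed
      obtain u where u: "acts \<phi> (E 1 False) u" using chart_acts[of "E 1 False"] by auto
      then obtain b e where be: "\<And>j s. E 1 False \<otimes>\<^bsub>D\<^esub> \<phi> (E j s) = \<phi> (E (u * j + b s) (s \<noteq> e))"
        by (auto simp: acts_def)
      have be: "E 1 False \<otimes>\<^bsub>D\<^esub> curve y j = \<phi> (E (u * (w * j) + b False) e)" for j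
        using be[of "w * j" False] by (simp add: cy)
      have x: "E 1 False = \<phi> (E (w * (2 - a)) False)" using \<open>odd a\<close> by (simp add: cy cj)
      have "E 1 False = \<phi> (E (b False) e)" using be[of 0] by (simp add: cj)
      then have e: "\<not> e" and b: "int n dvd w * (2 - a) - b False"
        using x by (simp_all add: chart_eq_iff)
      have shift: "int n dvd (u * i + 2 - a) - j" if "E 1 False \<otimes>\<^bsub>D\<^esub> curve y i = curve y j" for i j
      proof -
        have "\<phi> (E (u * (w * i) + b False) False) = \<phi> (E (w * j) False)"
          using that be[of i] e by (simp add: cy)
        then have "int n dvd (u * (w * i) + b False - w * j) + (w * (2 - a) - b False)"
          using b by (intro dvd_add) (simp_all add: chart_eq_iff)
        then have "int n dvd w * ((u * i + 2 - a) - j)" by (simp add: algebra_simps)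
        then show ?thesis by (simp only: dvd_coprime_cancel[OF w])
      qed
      have u1: "int n dvd (u * 1 + 2 - a) - (1 + a)" using \<open>odd a\<close> by (intro shift) (simp add: cj)
      have u2: "int n dvd (u * (2 - a) + 2 - a) - 2" using \<open>odd a\<close> by (intro shift) (simp add: cj)
      have u3: "int n dvd u * u - 1" by (rule acts_rotation_one[OF u])
      obtain k where "(u * 1 + 2 - a) - (1 + a) = int n * k" using u1 by (rule dvdE)
      then have k: "u = 2 * a - 1 + int n * k" by simp
      \<comment> \<open>the combination \<open>2 (2a(2 - a) - 2) + ((2a - 1)\<^sup>2 - 1) = 4(a - 1)\<close>, with \<open>u\<close> replaced by \<open>2a - 1\<close>\<close>
      have "int n dvd 2 * ((u * (2 - a) + 2 - a) - 2) + (u * u - 1) - (int n * k) * (2 * (2 - a) + (u + 2 * a - 1))"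
        by (intro dvd_diff dvd_add u3 dvd_mult[OF u2] dvd_mult2 dvd_triv_left)
      also have "2 * ((u * (2 - a) + 2 - a) - 2) + (u * u - 1) - (int n * k) * (2 * (2 - a) + (u + 2 * a - 1)) = 4 * (a - 1)"
        unfolding k by (simp add: algebra_simps)
      finally show ?thesis using False n \<open>odd a\<close> by (simp add: extendable_def a_def)
    qed
  qed
qed

text \<open>
  If \<open>y\<close> is not a representative, then \<open>4\<close> divides \<open>n\<close> and the unit \<open>1 + n/2\<close> replaces it by \<open>x\<^sup>n\<^sup>/\<^sup>2 y\<close>.
\<close>

lemma obtain_curve_reps:
  obtains w y where "coprime w (int n)" "y \<in> reps" "\<And>j. \<phi> (E (w * j) False) = curve y j"
proof -
  obtain w y where w: "coprime w (int n)" and y: "y \<in> carrier D"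
    and cy: "\<And>j. \<phi> (E (w * j) False) = curve y j"
    by (rule obtain_curve) blast
  note extendable = curve_extendable[OF w y cy]
  show ?thesis
  proof (cases "y \<in> reps")
    case True
    then show ?thesis using that w cy by blast
  next
    case False
    define y' where "y' = E (int (n div 2) + fst y) (snd y)"
    have "4 dvd n" and y': "y' \<in> reps" using extendable_reps[OF extendable y] False by (auto simp: y'_def)
    then obtain k where "n = 4 * k" by (metis dvdE)
    then have k: "int n = 4 * int k" and half: "int (n div 2) = 2 * int k" by simp_all
    define h where "h = 1 + 2 * int k"
    have "h * h - 1 = int n * (1 + int k)" by (simp add: h_def k algebra_simps)
    then have "coprime h (int n)" by (intro coprime_if_square) simp
    moreover have "\<phi> (E (w * h * j) False) = curve y' j" for j
    proof -
      have y'E: "E (fst y') (snd y') = E (2 * int k + fst y) (snd y)"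
        using E_fst_snd[OF reps_carrier[OF y']] by (simp only: y'_def half)
      have "\<phi> (E (w * h * j) False) = curve y (h * j)" by (simp add: cy[symmetric] mult.assoc)
      also have "\<dots> = curve y' j"
      proof (cases "even j")
        case True
        then show ?thesis by (auto simp: curve_def h_def k E_eq_iff algebra_simps elim!: evenE)
      next
        case False
        then obtain l where l: "j = 2 * l + 1" by (rule oddE)
        have "curve y' j = E (2 * l) False \<otimes>\<^bsub>D\<^esub> E (fst y') (snd y')" using l by (simp add: curve_def)
        also have "\<dots> = E (2 * l + (2 * int k + fst y)) (snd y)" by (simp add: y'E)
        also have "\<dots> = curve y (h * j)" using l by (simp add: curve_def h_def k E_eq_iff algebra_simps)
        finally show ?thesis ..
      qed
      finally show ?thesis .
    qed
    ultimately show ?thesis using that[of "w * h" y'] w y' by simp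
  qed
qed

text \<open>
  Translation by \<open>base y\<close> moves the curve off itself, hence onto the other half of the chart; its
  linear part is the speed \<open>q\<close>, and its shift is absorbed by the automorphism.
\<close>

lemma chart_complete:
  "\<exists>y\<in>reps. \<exists>q\<in>involutions. \<exists>\<alpha>\<in>iso D D. \<forall>d\<in>carrier D. chart y q d = \<phi> (\<alpha> d)"
proof -
  obtain w y where w: "coprime w (int n)" and y: "y \<in> reps"
    and cy: "\<And>j. \<phi> (E (w * j) False) = curve y j"
    by (rule obtain_curve_reps) blast
  note extendable = reps_extendable[OF y]
  obtain u where u: "acts \<phi> (base y) u" using chart_acts[of "base y"] by auto
  then obtain b e where be: "\<And>j s. base y \<otimes>\<^bsub>D\<^esub> \<phi> (E j s) = \<phi> (E (u * j + b s) (s \<noteq> e))"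
    by (auto simp: acts_def)
  have be: "base y \<otimes>\<^bsub>D\<^esub> curve y j = \<phi> (E (u * (w * j) + b False) e)" for j
    using be[of "w * j" False] by (simp add: cy)
  have e
  proof (rule ccontr)
    assume "\<not> e"
    obtain v where "[w * v = 1] (mod int n)" using cong_solve_coprime_int[OF w] by blast
    then have v: "int n dvd w * v - 1" by (simp add: cong_iff_dvd_diff)
    have "base y \<otimes>\<^bsub>D\<^esub> curve y 0 = \<phi> (E (b False) False)" using be[of 0] \<open>\<not> e\<close> by simp
    also have "\<dots> = \<phi> (E (w * (v * b False)) False)"
      using dvd_mult2[OF v, of "b False"]
      by (subst eq_commute) (simp add: chart_eq_iff algebra_simps)
    also have "\<dots> = curve y (v * b False)" by (simp add: cy)
    finally show False using base_curve_neq_curve[OF extendable] by blast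
  qed
  define q where "q = u mod int n"
  have qu: "int n dvd q - u" by (simp add: q_def mod_eq_dvd_iff[symmetric])
  have uu: "int n dvd u * u - 1" by (rule acts_base[OF u])
  have "int n dvd (q - u) * (q + u) + (u * u - 1)" "int n dvd u * (q - u) + (u * u - 1)"
    using qu uu by auto
  then have qq: "int n dvd q * q - 1" and uq: "int n dvd u * q - 1" by (simp_all add: algebra_simps)
  have "q \<in> involutions" using qq n_ge_3 by (simp add: involutions_def q_def)
  moreover have "chart y q (E j s) = \<phi> (aut w (b False) (E j s))" for j s
  proof (cases s)
    case True
    have "int n dvd w * j * (u * q - 1)" using uq by (rule dvd_mult)
    then show ?thesis
      using True \<open>e\<close> by (simp add: chart_E extendable be aut_E chart_eq_iff algebra_simps)
  qed (simp add: chart_E extendable cy aut_E)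
  ultimately show ?thesis
    unfolding ball_carrier_E using y aut_iso[OF w] by blast
qed

end

section \<open>The count\<close>

context dihedral
begin

lemma card_regular_set: "card (regular_set D D) = card reps * card (Upsilon n)"
proof -
  have "card (regular_set D D) = card (reps \<times> involutions)"
  proof (rule card_regular_set_transversal[where F = "\<lambda>(y, q). chart y q"])
    fix \<phi> assume "holomorph_chart D D \<phi>"
    then interpret dihedral_chart n \<phi> by unfold_locales
    show "\<exists>p\<in>reps \<times> involutions. \<exists>\<alpha>\<in>iso D D. \<forall>d\<in>carrier D. (case p of (y, q) \<Rightarrow> chart y q) d = \<phi> (\<alpha> d)"
      using chart_complete by (auto simp: split_beta)
  next
    fix p p' \<alpha>
    assume "p \<in> reps \<times> involutions" "p' \<in> reps \<times> involutions" "\<alpha> \<in> iso D D"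
      "\<forall>d\<in>carrier D. (case p of (y, q) \<Rightarrow> chart y q) d = (case p' of (y, q) \<Rightarrow> chart y q) (\<alpha> d)"
    then show "p = p'"
      using chart_distinct[of "fst p" "fst p'" "snd p" "snd p'" \<alpha>] by (auto simp: split_beta prod_eq_iff)
  qed (auto simp: involutions_def intro: chart_is_holomorph_chart reps_extendable)
  then show ?thesis by (simp add: card_cartesian_product involutions_eq_Upsilon)
qed

end

theorem mainTheorem1:
  fixes n :: nat
  assumes "n \<ge> 3"
  shows "card (regular_set (dihedral_group n) (dihedral_group n)) =
    (if 8 dvd n then (n div 2 + 2) * card (Upsilon n)
     else if 4 dvd n then (n div 2 + 1) * card (Upsilon n)
     else if 2 dvd n then (n + 1) * card (Upsilon n)
     else card (Upsilon n))"
proof -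
  interpret dihedral n using assms by unfold_locales
  have "8 dvd n \<Longrightarrow> 4 dvd n" "4 dvd n \<Longrightarrow> even n"
    using dvd_trans[of 4 8 n] dvd_trans[of 2 4 n] by auto
  then show ?thesis by (auto simp: card_regular_set card_reps)
qed

end
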